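(* Let $\varphi$ be a formula and let $w$ be an infinite word over $2^{\mathrm{Var}(\varphi)}$ that is stable with respect to $\varphi$ at index $r\in\mathbb{N}$. Then $w\models\varphi$ if and only if there exist $M\subseteq\mu(\varphi)$ and $N\subseteq\nu(\varphi)$ such that all of the following hold: 1) $w_r\models \mathit{af}_\ell(\varphi,w_{0r},\vec C_{\varphi,r})\,[M\langle\circ\vec C_{\varphi,r}\rangle]_\nu$; 2) for all $\psi\in M$ and all $s\in\mathbb{N}$ there exists $t\ge s$ with $w_t\models \mathbf{F}\big(\psi\langle\circ\vec C_{\varphi,t}\rangle[N\langle\circ\vec C_{\varphi,t}\rangle]_\mu\big)$; 3) for all $\psi\in N$ there exists $t\ge 0$ with $w_t\models \mathbf{G}\big(\psi\langle\circ\vec C_{\varphi,t}\rangle[M\langle\circ\vec C_{\varphi,t}\rangle]_\nu\big)$.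
   Context: Syntax. Formulae are pLTL formulae in negation normal form: built from $\top,\bot$, literals $p,\neg p$ ($p$ an atomic proposition), $\wedge,\vee$, future operators $\mathbf{X}$ (unary), $\mathbf{U},\mathbf{W},\mathbf{R},\mathbf{M}$ (binary), and past operators $\mathbf{Y},\tilde{\mathbf{Y}}$ (unary), $\mathbf{S},\tilde{\mathbf{S}},\mathbf{B},\tilde{\mathbf{B}}$ (binary). $\mathrm{Var}(\varphi)$ is the set of atomic propositions in $\varphi$. Shorthand: $\mathbf{F}\psi=\top\mathbf{U}\psi$, $\mathbf{G}\psi=\psi\mathbf{W}\bot$. Semantics. For an infinite word $w=\sigma_0\sigma_1\dots$ of sets of propositions and $t\in\mathbb{N}$: $(w,t)\models p$ iff $p\in\sigma_t$; Boolean cases as usual; $(w,t)\models\mathbf{X}\psi$ iff $(w,t+1)\models\psi$; $(w,t)\models\mathbf{Y}\psi$ iff $t>0$ and $(w,t-1)\models\psi$; $(w,t)\models\tilde{\mathbf{Y}}\psi$ iff $t=0$ or $(w,t-1)\models\psi$; $(w,t)\models\psi\mathbf{U}\xi$ iff $\exists r\ge t$ with $(w,r)\models\xi$ and $(w,s)\models\psi$ for all $s\in[t,r)$; $(w,t)\models\psi\mathbf{S}\xi$ iff $\exists r\le t$ with $(w,r)\models\xi$ and $(w,s)\models\psi$ for all $s\in(r,t]$; $\psi\mathbf{W}\xi$ holds at $t$ iff $\psi\mathbf{U}\xi$ holds at $t$ or $\psi$ holds at all $s\ge t$; $\psi\tilde{\mathbf{S}}\xi$ holds at $t$ iff $\psi\mathbf{S}\xi$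 holds at $t$ or $\psi$ holds at all $s\le t$; $\psi\mathbf{M}\xi:=\xi\mathbf{U}(\psi\wedge\xi)$, $\psi\mathbf{R}\xi:=\xi\mathbf{W}(\psi\wedge\xi)$, $\psi\mathbf{B}\xi:=\xi\mathbf{S}(\psi\wedge\xi)$, $\psi\tilde{\mathbf{B}}\xi:=\xi\tilde{\mathbf{S}}(\psi\wedge\xi)$ (semantically). $w\models\varphi$ means $(w,0)\models\varphi$. $w_t$ is the suffix $\sigma_t\sigma_{t+1}\dots$ and $w_{0t}$ the prefix $\sigma_0\dots\sigma_{t-1}$ (empty if $t=0$). Rewriting. A past formula is one whose root is one of $\mathbf{Y},\tilde{\mathbf{Y}},\mathbf{S},\tilde{\mathbf{S}},\mathbf{B},\tilde{\mathbf{B}}$; $\mathit{psf}(\varphi)$ is the set of past subformulae of $\varphi$. The weakening $\varphi_{\mathcal W}$ replaces a root operator $\mathbf{Y},\mathbf{S},\mathbf{B}$ by $\tilde{\mathbf{Y}},\tilde{\mathbf{S}},\tilde{\mathbf{B}}$ respectively (otherwise $\varphi_{\mathcal W}=\varphi$); the strengthening $\varphi_{\mathcal S}$ replaces a root $\tilde{\mathbf{Y}},\tilde{\mathbf{S}},\tilde{\mathbf{B}}$ by $\mathbf{Y},\mathbf{S},\mathbf{B}$ (otherwise $\varphi_{\mathcal S}=\varphi$). For a set $C$ of past formulae, $\varphi\langle C\rangle$ is defined recursively: atoms are unchanged; $(\mathit{op}\,\psi)\langle C\rangle$ is $(\mathit{op}\,\psi\langle C\rangle)_{\mathcal W}$ if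 $\mathit{op}\,\psi\in C$ and $(\mathit{op}\,\psi\langle C\rangle)_{\mathcal S}$ otherwise; $(\psi\,\mathit{op}\,\xi)\langle C\rangle$ is $(\psi\langle C\rangle\,\mathit{op}\,\xi\langle C\rangle)_{\mathcal W}$ if $\psi\,\mathit{op}\,\xi\in C$ and $(\psi\langle C\rangle\,\mathit{op}\,\xi\langle C\rangle)_{\mathcal S}$ otherwise. For a set $S$ of formulae, $S\langle C\rangle=\{s\langle C\rangle\mid s\in S\}$. Weakening conditions: $\mathit{wc}(\mathbf{Y}\psi)=\mathit{wc}(\tilde{\mathbf{Y}}\psi)=\psi$, $\mathit{wc}(\psi\mathbf{S}\xi)=\xi$, $\mathit{wc}(\psi\tilde{\mathbf{S}}\xi)=\psi\vee\xi$, $\mathit{wc}(\psi\mathbf{B}\xi)=\psi\wedge\xi$, $\mathit{wc}(\psi\tilde{\mathbf{B}}\xi)=\xi$. Entailed sets (for the given $w$). $C_{\varphi,0}=\{\psi\in\mathit{psf}(\varphi)\mid\psi=\psi_{\mathcal W}\}$ and, for $t>0$, $C_{\varphi,t}=\{\psi\in\mathit{psf}(\varphi\langle C_{\varphi,0}\rangle\langle C_{\varphi,1}\rangle\cdots\langle C_{\varphi,t-1}\rangle)\mid w_{t-1}\models\mathit{wc}(\psi)\}$. $\vec C_{\varphi,t}$ is the sequence $C_{\varphi,0},\dots,C_{\varphi,t}$, and $\circ\vec C_{\varphi,t}=\{\psi\in\mathit{psf}(\varphi)\mid \psi\langle C_{\varphi,0}\rangle\cdots\langle C_{\varphi,t}\rangle=(\psi\langle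 C_{\varphi,0}\rangle\cdots\langle C_{\varphi,t}\rangle)_{\mathcal W}\}$ (so that $\varphi\langle\circ\vec C_{\varphi,t}\rangle=\varphi\langle C_{\varphi,0}\rangle\cdots\langle C_{\varphi,t}\rangle$). Local after-function. For a letter $\sigma$ and a set $C$ of past formulae, define by mutual recursion $\mathit{af}_\ell$ and $\mathit{pu}_\ell$: $\mathit{af}_\ell(\top,\sigma,C)=\top$; $\mathit{af}_\ell(\bot,\sigma,C)=\bot$; $\mathit{af}_\ell(p,\sigma,C)=\top$ if $p\in\sigma$, else $\bot$; $\mathit{af}_\ell(\neg p,\sigma,C)=\bot$ if $p\in\sigma$, else $\top$; $\mathit{af}_\ell(\mathbf{X}\psi,\sigma,C)=\mathit{pu}_\ell(\psi,\sigma,C)$; $\mathit{af}_\ell(\mathbf{Y}\psi,\sigma,C)=\bot$; $\mathit{af}_\ell(\tilde{\mathbf{Y}}\psi,\sigma,C)=\top$; $\mathit{af}_\ell$ commutes with $\wedge,\vee$; for $\mathit{op}\in\{\mathbf{U},\mathbf{W}\}$: $\mathit{af}_\ell(\psi\,\mathit{op}\,\xi,\sigma,C)=\mathit{af}_\ell(\xi,\sigma,C)\vee(\mathit{af}_\ell(\psi,\sigma,C)\wedge\mathit{pu}_\ell(\psi\,\mathit{op}\,\xi,\sigma,C))$; for $\mathit{op}\in\{\mathbf{R},\mathbf{M}\}$: $\mathit{af}_\ell(\psi\,\mathit{op}\,\xi,\sigma,C)=\mathit{af}_\ell(\xi,\sigma,C)\wedge(\mathit{af}_\ell(\psi,\sigma,C)\vee\mathit{pu}_\ell(\psi\,\mathit{op}\,\xi,\sigma,C))$;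 for $\mathit{op}\in\{\mathbf{S},\tilde{\mathbf{S}},\mathbf{B},\tilde{\mathbf{B}}\}$: $\mathit{af}_\ell(\psi\,\mathit{op}\,\xi,\sigma,C)=\mathit{af}_\ell(\mathit{wc}(\psi\,\mathit{op}\,\xi),\sigma,C)$; and $\mathit{pu}_\ell(\varphi,\sigma,C)=\varphi\langle C\rangle\wedge\bigwedge_{\psi\in\mathit{psf}(\varphi)\cap C}\mathit{af}_\ell(\mathit{wc}(\psi),\sigma,C)$. Extension to a finite word $\sigma_0\dots\sigma_{n-1}$ and a sequence $\vec C=C_0,\dots,C_n$: $\mathit{af}_\ell(\varphi,\sigma_0\dots\sigma_{n-1},\vec C)=\varphi_n$, where $\varphi_0=\varphi$ and $\varphi_{i}=\mathit{af}_\ell(\varphi_{i-1},\sigma_{i-1},C_{i})$ for $1\le i\le n$ (so $C_0$ is not used). Stability. $\mu(\varphi)$ is the set of subformulae of $\varphi$ with root $\mathbf{U}$ or $\mathbf{M}$; $\nu(\varphi)$ those with root $\mathbf{W}$ or $\mathbf{R}$. $w$ is stable with respect to $\varphi$ at index $t$ if $\{\psi\in\mu(\varphi)\mid(w,t)\models\mathbf{F}\psi\}=\{\psi\in\mu(\varphi)\mid(w,t)\models\mathbf{G}\mathbf{F}\psi\}$ and $\{\psi\in\nu(\varphi)\mid(w,t)\models\mathbf{G}\psi\}=\{\psi\in\nu(\varphi)\mid(w,t)\models\mathbf{F}\mathbf{G}\psi\}$. Rewriting by $M$, $N$. $\varphi[M]_\nu$ is defined recursively: $(\psi\mathbf{U}\xi)[M]_\nu$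 is $(\psi[M]_\nu)\mathbf{W}(\xi[M]_\nu)$ if $\psi\mathbf{U}\xi\in M$ and $\bot$ otherwise; $(\psi\mathbf{M}\xi)[M]_\nu$ is $(\psi[M]_\nu)\mathbf{R}(\xi[M]_\nu)$ if $\psi\mathbf{M}\xi\in M$ and $\bot$ otherwise; atoms are unchanged and all other operators (Boolean, $\mathbf{X},\mathbf{W},\mathbf{R}$ and past) are kept, with recursion on the operands. $\varphi[N]_\mu$ is defined recursively: $(\psi\mathbf{W}\xi)[N]_\mu$ is $\top$ if $\psi\mathbf{W}\xi\in N$ and $(\psi[N]_\mu)\mathbf{U}(\xi[N]_\mu)$ otherwise; $(\psi\mathbf{R}\xi)[N]_\mu$ is $\top$ if $\psi\mathbf{R}\xi\in N$ and $(\psi[N]_\mu)\mathbf{M}(\xi[N]_\mu)$ otherwise; atoms unchanged and all other operators kept with recursion on the operands. *)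

theory Defs
  imports Main "HOL-Library.Omega_Words_Fun"
begin

text \<open>
  Formulae of linear temporal logic with past, in negation normal form. \<open>SRelease\<close> is the strong
  release \<open>M\<close>. \<open>WYesterday\<close>, \<open>WSince\<close> and \<open>WBefore\<close> are the weak versions (written with
  a tilde on paper) of \<open>Yesterday\<close> (\<open>Y\<close>), \<open>Since\<close> (\<open>S\<close>) and \<open>Before\<close> (\<open>B\<close>).
\<close>

datatype (vars: 'a) pltl =
    Top
  | Bot
  | Prop 'a
  | NProp 'a
  | And "'a pltl" "'a pltl"
  | Or "'a pltl" "'a pltl"
  | Next "'a pltl"
  | Until "'a pltl" "'a pltl"
  | WUntil "'a pltl" "'a pltl"
  | Release "'a pltl" "'a pltl"
  | SRelease "'a pltl" "'a pltl"
  | Yesterday "'a pltl"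
  | WYesterday "'a pltl"
  | Since "'a pltl" "'a pltl"
  | WSince "'a pltl" "'a pltl"
  | Before "'a pltl" "'a pltl"
  | WBefore "'a pltl" "'a pltl"

abbreviation Finally :: "'a pltl \<Rightarrow> 'a pltl" where
  "Finally \<psi> \<equiv> Until Top \<psi>"

abbreviation Globally :: "'a pltl \<Rightarrow> 'a pltl" where
  "Globally \<psi> \<equiv> WUntil \<psi> Bot"

subsection \<open>Semantics\<close>

definition until_at :: "(nat \<Rightarrow> bool) \<Rightarrow> (nat \<Rightarrow> bool) \<Rightarrow> nat \<Rightarrow> bool" where
  "until_at P Q t \<longleftrightarrow> (\<exists>r\<ge>t. Q r \<and> (\<forall>s. t \<le> s \<and> s < r \<longrightarrow> P s))"

definition wuntil_at :: "(nat \<Rightarrow> bool) \<Rightarrow> (nat \<Rightarrow> bool) \<Rightarrow> nat \<Rightarrow> bool" where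
  "wuntil_at P Q t \<longleftrightarrow> until_at P Q t \<or> (\<forall>s\<ge>t. P s)"

definition since_at :: "(nat \<Rightarrow> bool) \<Rightarrow> (nat \<Rightarrow> bool) \<Rightarrow> nat \<Rightarrow> bool" where
  "since_at P Q t \<longleftrightarrow> (\<exists>r\<le>t. Q r \<and> (\<forall>s. r < s \<and> s \<le> t \<longrightarrow> P s))"

definition wsince_at :: "(nat \<Rightarrow> bool) \<Rightarrow> (nat \<Rightarrow> bool) \<Rightarrow> nat \<Rightarrow> bool" where
  "wsince_at P Q t \<longleftrightarrow> since_at P Q t \<or> (\<forall>s\<le>t. P s)"

primrec sat :: "'a set word \<Rightarrow> nat \<Rightarrow> 'a pltl \<Rightarrow> bool" where
  "sat w t Top \<longleftrightarrow> True"
| "sat w t Bot \<longleftrightarrow> False"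
| "sat w t (Prop p) \<longleftrightarrow> p \<in> w t"
| "sat w t (NProp p) \<longleftrightarrow> p \<notin> w t"
| "sat w t (And \<psi> \<xi>) \<longleftrightarrow> sat w t \<psi> \<and> sat w t \<xi>"
| "sat w t (Or \<psi> \<xi>) \<longleftrightarrow> sat w t \<psi> \<or> sat w t \<xi>"
| "sat w t (Next \<psi>) \<longleftrightarrow> sat w (t + 1) \<psi>"
| "sat w t (Until \<psi> \<xi>) \<longleftrightarrow> until_at (\<lambda>s. sat w s \<psi>) (\<lambda>s. sat w s \<xi>) t"
| "sat w t (WUntil \<psi> \<xi>) \<longleftrightarrow> wuntil_at (\<lambda>s. sat w s \<psi>) (\<lambda>s. sat w s \<xi>) t"
| "sat w t (Release \<psi> \<xi>) \<longleftrightarrow> wuntil_at (\<lambda>s. sat w s \<xi>) (\<lambda>s. sat w s \<psi> \<and> sat w s \<xi>) t"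
| "sat w t (SRelease \<psi> \<xi>) \<longleftrightarrow> until_at (\<lambda>s. sat w s \<xi>) (\<lambda>s. sat w s \<psi> \<and> sat w s \<xi>) t"
| "sat w t (Yesterday \<psi>) \<longleftrightarrow> t > 0 \<and> sat w (t - 1) \<psi>"
| "sat w t (WYesterday \<psi>) \<longleftrightarrow> t = 0 \<or> sat w (t - 1) \<psi>"
| "sat w t (Since \<psi> \<xi>) \<longleftrightarrow> since_at (\<lambda>s. sat w s \<psi>) (\<lambda>s. sat w s \<xi>) t"
| "sat w t (WSince \<psi> \<xi>) \<longleftrightarrow> wsince_at (\<lambda>s. sat w s \<psi>) (\<lambda>s. sat w s \<xi>) t"
| "sat w t (Before \<psi> \<xi>) \<longleftrightarrow> since_at (\<lambda>s. sat w s \<xi>) (\<lambda>s. sat w s \<psi> \<and> sat w s \<xi>) t"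
| "sat w t (WBefore \<psi> \<xi>) \<longleftrightarrow> wsince_at (\<lambda>s. sat w s \<xi>) (\<lambda>s. sat w s \<psi> \<and> sat w s \<xi>) t"

abbreviation models :: "'a set word \<Rightarrow> 'a pltl \<Rightarrow> bool" (infix "\<Turnstile>" 50) where
  "w \<Turnstile> \<phi> \<equiv> sat w 0 \<phi>"

subsection \<open>Subformulae\<close>

primrec subformulae :: "'a pltl \<Rightarrow> 'a pltl set" where
  "subformulae Top = {Top}"
| "subformulae Bot = {Bot}"
| "subformulae (Prop p) = {Prop p}"
| "subformulae (NProp p) = {NProp p}"
| "subformulae (And \<psi> \<xi>) = {And \<psi> \<xi>} \<union> subformulae \<psi> \<union> subformulae \<xi>"
| "subformulae (Or \<psi> \<xi>) = {Or \<psi> \<xi>} \<union> subformulae \<psi> \<union> subformulae \<xi>"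
| "subformulae (Next \<psi>) = {Next \<psi>} \<union> subformulae \<psi>"
| "subformulae (Until \<psi> \<xi>) = {Until \<psi> \<xi>} \<union> subformulae \<psi> \<union> subformulae \<xi>"
| "subformulae (WUntil \<psi> \<xi>) = {WUntil \<psi> \<xi>} \<union> subformulae \<psi> \<union> subformulae \<xi>"
| "subformulae (Release \<psi> \<xi>) = {Release \<psi> \<xi>} \<union> subformulae \<psi> \<union> subformulae \<xi>"
| "subformulae (SRelease \<psi> \<xi>) = {SRelease \<psi> \<xi>} \<union> subformulae \<psi> \<union> subformulae \<xi>"
| "subformulae (Yesterday \<psi>) = {Yesterday \<psi>} \<union> subformulae \<psi>"
| "subformulae (WYesterday \<psi>) = {WYesterday \<psi>} \<union> subformulae \<psi>"
| "subformulae (Since \<psi> \<xi>) = {Since \<psi> \<xi>} \<union> subformulae \<psi> \<union> subformulae \<xi>"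
| "subformulae (WSince \<psi> \<xi>) = {WSince \<psi> \<xi>} \<union> subformulae \<psi> \<union> subformulae \<xi>"
| "subformulae (Before \<psi> \<xi>) = {Before \<psi> \<xi>} \<union> subformulae \<psi> \<union> subformulae \<xi>"
| "subformulae (WBefore \<psi> \<xi>) = {WBefore \<psi> \<xi>} \<union> subformulae \<psi> \<union> subformulae \<xi>"

fun is_past :: "'a pltl \<Rightarrow> bool" where
  "is_past (Yesterday _) = True"
| "is_past (WYesterday _) = True"
| "is_past (Since _ _) = True"
| "is_past (WSince _ _) = True"
| "is_past (Before _ _) = True"
| "is_past (WBefore _ _) = True"
| "is_past _ = False"

definition psf :: "'a pltl \<Rightarrow> 'a pltl set" where
  "psf \<phi> = {\<psi> \<in> subformulae \<phi>. is_past \<psi>}"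

definition mu :: "'a pltl \<Rightarrow> 'a pltl set" where
  "mu \<phi> = {\<psi> \<in> subformulae \<phi>. \<exists>\<alpha> \<beta>. \<psi> = Until \<alpha> \<beta> \<or> \<psi> = SRelease \<alpha> \<beta>}"

definition nu :: "'a pltl \<Rightarrow> 'a pltl set" where
  "nu \<phi> = {\<psi> \<in> subformulae \<phi>. \<exists>\<alpha> \<beta>. \<psi> = WUntil \<alpha> \<beta> \<or> \<psi> = Release \<alpha> \<beta>}"

lemma finite_subformulae: "finite (subformulae \<phi>)"
  by (induction \<phi>) auto

lemma finite_psf: "finite (psf \<phi>)"
  by (simp add: psf_def finite_subformulae)

subsection \<open>Weakening, strengthening and rewriting of past formulae\<close>

fun weaken :: "'a pltl \<Rightarrow> 'a pltl" where
  "weaken (Yesterday \<psi>) = WYesterday \<psi>"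
| "weaken (Since \<psi> \<xi>) = WSince \<psi> \<xi>"
| "weaken (Before \<psi> \<xi>) = WBefore \<psi> \<xi>"
| "weaken \<phi> = \<phi>"

fun strengthen :: "'a pltl \<Rightarrow> 'a pltl" where
  "strengthen (WYesterday \<psi>) = Yesterday \<psi>"
| "strengthen (WSince \<psi> \<xi>) = Since \<psi> \<xi>"
| "strengthen (WBefore \<psi> \<xi>) = Before \<psi> \<xi>"
| "strengthen \<phi> = \<phi>"

text \<open>
  \<open>rewrite \<phi> C\<close> is written \<open>\<phi>\<langle>C\<rangle>\<close> on paper. As weakening and strengthening only
  affect formulae with a past operator at the root, the remaining operators are simply kept.
\<close>

primrec rewrite :: "'a pltl \<Rightarrow> 'a pltl set \<Rightarrow> 'a pltl" where
  "rewrite Top C = Top"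
| "rewrite Bot C = Bot"
| "rewrite (Prop p) C = Prop p"
| "rewrite (NProp p) C = NProp p"
| "rewrite (And \<psi> \<xi>) C = And (rewrite \<psi> C) (rewrite \<xi> C)"
| "rewrite (Or \<psi> \<xi>) C = Or (rewrite \<psi> C) (rewrite \<xi> C)"
| "rewrite (Next \<psi>) C = Next (rewrite \<psi> C)"
| "rewrite (Until \<psi> \<xi>) C = Until (rewrite \<psi> C) (rewrite \<xi> C)"
| "rewrite (WUntil \<psi> \<xi>) C = WUntil (rewrite \<psi> C) (rewrite \<xi> C)"
| "rewrite (Release \<psi> \<xi>) C = Release (rewrite \<psi> C) (rewrite \<xi> C)"
| "rewrite (SRelease \<psi> \<xi>) C = SRelease (rewrite \<psi> C) (rewrite \<xi> C)"
| "rewrite (Yesterday \<psi>) C =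
    (if Yesterday \<psi> \<in> C then weaken else strengthen) (Yesterday (rewrite \<psi> C))"
| "rewrite (WYesterday \<psi>) C =
    (if WYesterday \<psi> \<in> C then weaken else strengthen) (WYesterday (rewrite \<psi> C))"
| "rewrite (Since \<psi> \<xi>) C =
    (if Since \<psi> \<xi> \<in> C then weaken else strengthen) (Since (rewrite \<psi> C) (rewrite \<xi> C))"
| "rewrite (WSince \<psi> \<xi>) C =
    (if WSince \<psi> \<xi> \<in> C then weaken else strengthen) (WSince (rewrite \<psi> C) (rewrite \<xi> C))"
| "rewrite (Before \<psi> \<xi>) C =
    (if Before \<psi> \<xi> \<in> C then weaken else strengthen) (Before (rewrite \<psi> C) (rewrite \<xi> C))"
| "rewrite (WBefore \<psi> \<xi>) C =
    (if WBefore \<psi> \<xi> \<in> C then weaken else strengthen) (WBefore (rewrite \<psi> C) (rewrite \<xi> C))"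

definition rewrite_set :: "'a pltl set \<Rightarrow> 'a pltl set \<Rightarrow> 'a pltl set" where
  "rewrite_set S C = (\<lambda>\<psi>. rewrite \<psi> C) ` S"

text \<open>\<open>rewrite_seq \<phi> [C\<^sub>0, \<dots>, C\<^sub>n]\<close> is \<open>\<phi>\<langle>C\<^sub>0\<rangle>\<dots>\<langle>C\<^sub>n\<rangle>\<close>.\<close>

definition rewrite_seq :: "'a pltl \<Rightarrow> 'a pltl set list \<Rightarrow> 'a pltl" where
  "rewrite_seq \<phi> Cs = foldl rewrite \<phi> Cs"

text \<open>The weakening condition is only relevant for past formulae; the last equation is a dummy.\<close>

fun wc :: "'a pltl \<Rightarrow> 'a pltl" where
  "wc (Yesterday \<psi>) = \<psi>"
| "wc (WYesterday \<psi>) = \<psi>"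
| "wc (Since \<psi> \<xi>) = \<xi>"
| "wc (WSince \<psi> \<xi>) = Or \<psi> \<xi>"
| "wc (Before \<psi> \<xi>) = And \<psi> \<xi>"
| "wc (WBefore \<psi> \<xi>) = \<xi>"
| "wc \<phi> = \<phi>"

subsection \<open>Entailed sets of past subformulae\<close>

fun entailed :: "'a pltl \<Rightarrow> 'a set word \<Rightarrow> nat \<Rightarrow> 'a pltl set" where
  "entailed \<phi> w 0 = {\<psi> \<in> psf \<phi>. \<psi> = weaken \<psi>}"
| "entailed \<phi> w (Suc t) =
    {\<psi> \<in> psf (rewrite_seq \<phi> (map (\<lambda>i. entailed \<phi> w i) [0..<Suc t])). suffix t w \<Turnstile> wc \<psi>}"

definition entailed_seq :: "'a pltl \<Rightarrow> 'a set word \<Rightarrow> nat \<Rightarrow> 'a pltl set list" where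
  "entailed_seq \<phi> w t = map (entailed \<phi> w) [0..<Suc t]"

definition entailed_comp :: "'a pltl \<Rightarrow> 'a set word \<Rightarrow> nat \<Rightarrow> 'a pltl set" where
  "entailed_comp \<phi> w t =
    {\<psi> \<in> psf \<phi>. rewrite_seq \<psi> (entailed_seq \<phi> w t) = weaken (rewrite_seq \<psi> (entailed_seq \<phi> w t))}"

subsection \<open>The local after-function\<close>

text \<open>
  Conjunction of a finite set of formulae, taken in an arbitrary but fixed order; the empty
  conjunction is \<open>Top\<close>.
\<close>

definition Conj :: "'a pltl set \<Rightarrow> 'a pltl" where
  "Conj A = foldr And (SOME xs. distinct xs \<and> set xs = A) Top"

lemma sat_Conj:
  assumes "finite A"
  shows "sat w t (Conj A) \<longleftrightarrow> (\<forall>\<psi>\<in>A. sat w t \<psi>)"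
proof -
  define xs where "xs = (SOME xs. distinct xs \<and> set xs = A)"
  have "\<exists>xs. distinct xs \<and> set xs = A"
    using finite_distinct_list[OF assms] by blast
  then have "set xs = A"
    unfolding xs_def by (rule someI2_ex) simp
  moreover have "sat w t (foldr And ys Top) \<longleftrightarrow> (\<forall>\<psi>\<in>set ys. sat w t \<psi>)" for ys
    by (induction ys) auto
  ultimately show ?thesis
    unfolding Conj_def xs_def by blast
qed

text \<open>
  Termination measure for the after-function: binary past operators have weight 2, so that the
  weakening condition of a past formula is always smaller than the formula itself.
\<close>

primrec weight :: "'a pltl \<Rightarrow> nat" where
  "weight Top = 1"
| "weight Bot = 1"
| "weight (Prop p) = 1"
| "weight (NProp p) = 1"
| "weight (And \<psi> \<xi>) = weight \<psi> + weight \<xi> + 1"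
| "weight (Or \<psi> \<xi>) = weight \<psi> + weight \<xi> + 1"
| "weight (Next \<psi>) = weight \<psi> + 1"
| "weight (Until \<psi> \<xi>) = weight \<psi> + weight \<xi> + 1"
| "weight (WUntil \<psi> \<xi>) = weight \<psi> + weight \<xi> + 1"
| "weight (Release \<psi> \<xi>) = weight \<psi> + weight \<xi> + 1"
| "weight (SRelease \<psi> \<xi>) = weight \<psi> + weight \<xi> + 1"
| "weight (Yesterday \<psi>) = weight \<psi> + 1"
| "weight (WYesterday \<psi>) = weight \<psi> + 1"
| "weight (Since \<psi> \<xi>) = weight \<psi> + weight \<xi> + 2"
| "weight (WSince \<psi> \<xi>) = weight \<psi> + weight \<xi> + 2"
| "weight (Before \<psi> \<xi>) = weight \<psi> + weight \<xi> + 2"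
| "weight (WBefore \<psi> \<xi>) = weight \<psi> + weight \<xi> + 2"

lemma weight_subformula: "\<psi> \<in> subformulae \<phi> \<Longrightarrow> weight \<psi> \<le> weight \<phi>"
  by (induction \<phi>) auto

lemma weight_wc: "is_past \<psi> \<Longrightarrow> weight (wc \<psi>) < weight \<psi>"
  by (cases \<psi>) auto

lemma weight_wc_psf: "\<psi> \<in> psf \<phi> \<Longrightarrow> weight (wc \<psi>) < weight \<phi>"
  using weight_subformula weight_wc by (fastforce simp: psf_def)

function af :: "'a pltl \<Rightarrow> 'a set \<Rightarrow> 'a pltl set \<Rightarrow> 'a pltl"
  and pu :: "'a pltl \<Rightarrow> 'a set \<Rightarrow> 'a pltl set \<Rightarrow> 'a pltl" where
  "af Top \<sigma> C = Top"
| "af Bot \<sigma> C = Bot"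
| "af (Prop p) \<sigma> C = (if p \<in> \<sigma> then Top else Bot)"
| "af (NProp p) \<sigma> C = (if p \<in> \<sigma> then Bot else Top)"
| "af (And \<psi> \<xi>) \<sigma> C = And (af \<psi> \<sigma> C) (af \<xi> \<sigma> C)"
| "af (Or \<psi> \<xi>) \<sigma> C = Or (af \<psi> \<sigma> C) (af \<xi> \<sigma> C)"
| "af (Next \<psi>) \<sigma> C = pu \<psi> \<sigma> C"
| "af (Until \<psi> \<xi>) \<sigma> C = Or (af \<xi> \<sigma> C) (And (af \<psi> \<sigma> C) (pu (Until \<psi> \<xi>) \<sigma> C))"
| "af (WUntil \<psi> \<xi>) \<sigma> C = Or (af \<xi> \<sigma> C) (And (af \<psi> \<sigma> C) (pu (WUntil \<psi> \<xi>) \<sigma> C))"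
| "af (Release \<psi> \<xi>) \<sigma> C = And (af \<xi> \<sigma> C) (Or (af \<psi> \<sigma> C) (pu (Release \<psi> \<xi>) \<sigma> C))"
| "af (SRelease \<psi> \<xi>) \<sigma> C = And (af \<xi> \<sigma> C) (Or (af \<psi> \<sigma> C) (pu (SRelease \<psi> \<xi>) \<sigma> C))"
| "af (Yesterday \<psi>) \<sigma> C = Bot"
| "af (WYesterday \<psi>) \<sigma> C = Top"
| "af (Since \<psi> \<xi>) \<sigma> C = af (wc (Since \<psi> \<xi>)) \<sigma> C"
| "af (WSince \<psi> \<xi>) \<sigma> C = af (wc (WSince \<psi> \<xi>)) \<sigma> C"
| "af (Before \<psi> \<xi>) \<sigma> C = af (wc (Before \<psi> \<xi>)) \<sigma> C"
| "af (WBefore \<psi> \<xi>) \<sigma> C = af (wc (WBefore \<psi> \<xi>)) \<sigma> C"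
| "pu \<phi> \<sigma> C = And (rewrite \<phi> C) (Conj ((\<lambda>\<psi>. af (wc \<psi>) \<sigma> C) ` (psf \<phi> \<inter> C)))"
  by pat_completeness auto

termination
  by (relation "measure (\<lambda>x. case x of Inl (\<phi>, _, _) \<Rightarrow> 2 * weight \<phi> + 1 | Inr (\<phi>, _, _) \<Rightarrow> 2 * weight \<phi>)")
    (auto dest: weight_wc_psf)

text \<open>The initial entry \<open>C\<^sub>0\<close> of the sequence is not used, hence \<open>tl\<close>.\<close>

definition af_seq :: "'a pltl \<Rightarrow> 'a set list \<Rightarrow> 'a pltl set list \<Rightarrow> 'a pltl" where
  "af_seq \<phi> u Cs = foldl (\<lambda>\<psi> (\<sigma>, C). af \<psi> \<sigma> C) \<phi> (zip u (tl Cs))"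

subsection \<open>Stability and the limit rewritings\<close>

definition stable :: "'a set word \<Rightarrow> 'a pltl \<Rightarrow> nat \<Rightarrow> bool" where
  "stable w \<phi> t \<longleftrightarrow>
    {\<psi> \<in> mu \<phi>. sat w t (Finally \<psi>)} = {\<psi> \<in> mu \<phi>. sat w t (Globally (Finally \<psi>))} \<and>
    {\<psi> \<in> nu \<phi>. sat w t (Globally \<psi>)} = {\<psi> \<in> nu \<phi>. sat w t (Finally (Globally \<psi>))}"

primrec rewrite_nu :: "'a pltl \<Rightarrow> 'a pltl set \<Rightarrow> 'a pltl" ("_[_]\<^sub>\<nu>" [90, 0] 90) where
  "Top[M]\<^sub>\<nu> = Top"
| "Bot[M]\<^sub>\<nu> = Bot"
| "(Prop p)[M]\<^sub>\<nu> = Prop p"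
| "(NProp p)[M]\<^sub>\<nu> = NProp p"
| "(And \<psi> \<xi>)[M]\<^sub>\<nu> = And (\<psi>[M]\<^sub>\<nu>) (\<xi>[M]\<^sub>\<nu>)"
| "(Or \<psi> \<xi>)[M]\<^sub>\<nu> = Or (\<psi>[M]\<^sub>\<nu>) (\<xi>[M]\<^sub>\<nu>)"
| "(Next \<psi>)[M]\<^sub>\<nu> = Next (\<psi>[M]\<^sub>\<nu>)"
| "(Until \<psi> \<xi>)[M]\<^sub>\<nu> = (if Until \<psi> \<xi> \<in> M then WUntil (\<psi>[M]\<^sub>\<nu>) (\<xi>[M]\<^sub>\<nu>) else Bot)"
| "(WUntil \<psi> \<xi>)[M]\<^sub>\<nu> = WUntil (\<psi>[M]\<^sub>\<nu>) (\<xi>[M]\<^sub>\<nu>)"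
| "(Release \<psi> \<xi>)[M]\<^sub>\<nu> = Release (\<psi>[M]\<^sub>\<nu>) (\<xi>[M]\<^sub>\<nu>)"
| "(SRelease \<psi> \<xi>)[M]\<^sub>\<nu> = (if SRelease \<psi> \<xi> \<in> M then Release (\<psi>[M]\<^sub>\<nu>) (\<xi>[M]\<^sub>\<nu>) else Bot)"
| "(Yesterday \<psi>)[M]\<^sub>\<nu> = Yesterday (\<psi>[M]\<^sub>\<nu>)"
| "(WYesterday \<psi>)[M]\<^sub>\<nu> = WYesterday (\<psi>[M]\<^sub>\<nu>)"
| "(Since \<psi> \<xi>)[M]\<^sub>\<nu> = Since (\<psi>[M]\<^sub>\<nu>) (\<xi>[M]\<^sub>\<nu>)"
| "(WSince \<psi> \<xi>)[M]\<^sub>\<nu> = WSince (\<psi>[M]\<^sub>\<nu>) (\<xi>[M]\<^sub>\<nu>)"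
| "(Before \<psi> \<xi>)[M]\<^sub>\<nu> = Before (\<psi>[M]\<^sub>\<nu>) (\<xi>[M]\<^sub>\<nu>)"
| "(WBefore \<psi> \<xi>)[M]\<^sub>\<nu> = WBefore (\<psi>[M]\<^sub>\<nu>) (\<xi>[M]\<^sub>\<nu>)"

primrec rewrite_mu :: "'a pltl \<Rightarrow> 'a pltl set \<Rightarrow> 'a pltl" ("_[_]\<^sub>\<mu>" [90, 0] 90) where
  "Top[N]\<^sub>\<mu> = Top"
| "Bot[N]\<^sub>\<mu> = Bot"
| "(Prop p)[N]\<^sub>\<mu> = Prop p"
| "(NProp p)[N]\<^sub>\<mu> = NProp p"
| "(And \<psi> \<xi>)[N]\<^sub>\<mu> = And (\<psi>[N]\<^sub>\<mu>) (\<xi>[N]\<^sub>\<mu>)"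
| "(Or \<psi> \<xi>)[N]\<^sub>\<mu> = Or (\<psi>[N]\<^sub>\<mu>) (\<xi>[N]\<^sub>\<mu>)"
| "(Next \<psi>)[N]\<^sub>\<mu> = Next (\<psi>[N]\<^sub>\<mu>)"
| "(Until \<psi> \<xi>)[N]\<^sub>\<mu> = Until (\<psi>[N]\<^sub>\<mu>) (\<xi>[N]\<^sub>\<mu>)"
| "(WUntil \<psi> \<xi>)[N]\<^sub>\<mu> = (if WUntil \<psi> \<xi> \<in> N then Top else Until (\<psi>[N]\<^sub>\<mu>) (\<xi>[N]\<^sub>\<mu>))"
| "(Release \<psi> \<xi>)[N]\<^sub>\<mu> = (if Release \<psi> \<xi> \<in> N then Top else SRelease (\<psi>[N]\<^sub>\<mu>) (\<xi>[N]\<^sub>\<mu>))"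
| "(SRelease \<psi> \<xi>)[N]\<^sub>\<mu> = SRelease (\<psi>[N]\<^sub>\<mu>) (\<xi>[N]\<^sub>\<mu>)"
| "(Yesterday \<psi>)[N]\<^sub>\<mu> = Yesterday (\<psi>[N]\<^sub>\<mu>)"
| "(WYesterday \<psi>)[N]\<^sub>\<mu> = WYesterday (\<psi>[N]\<^sub>\<mu>)"
| "(Since \<psi> \<xi>)[N]\<^sub>\<mu> = Since (\<psi>[N]\<^sub>\<mu>) (\<xi>[N]\<^sub>\<mu>)"
| "(WSince \<psi> \<xi>)[N]\<^sub>\<mu> = WSince (\<psi>[N]\<^sub>\<mu>) (\<xi>[N]\<^sub>\<mu>)"
| "(Before \<psi> \<xi>)[N]\<^sub>\<mu> = Before (\<psi>[N]\<^sub>\<mu>) (\<xi>[N]\<^sub>\<mu>)"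
| "(WBefore \<psi> \<xi>)[N]\<^sub>\<mu> = WBefore (\<psi>[N]\<^sub>\<mu>) (\<xi>[N]\<^sub>\<mu>)"

end

theory Submission imports Defs begin

text \<open>
  Rewriting by the entailed sets encodes the truth values of the past formulae at the current
  position in their weak or strong roots, so that \<open>(w, t + n) \<Turnstile> \<psi>\<close> iff \<open>(w\<^sub>t, n) \<Turnstile> \<psi>\<langle>C\<^sub>0\<rangle>\<dots>\<langle>C\<^sub>t\<rangle>\<close>.
  In particular, formulae identified by the rewriting at \<open>t\<close> agree from \<open>t\<close> on. The theorem then
  reduces to the argument known from future LTL. If \<open>w\<close> satisfies \<open>\<phi>\<close>, let \<open>M\<close> contain the
  \<open>\<mu>\<close>-formulae that hold infinitely often and \<open>N\<close> the \<open>\<nu>\<close>-formulae that hold almost always;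
  stability makes the rewriting by \<open>M\<close> sound from \<open>r\<close> on. Conversely, conditions 2 and 3 imply, by
  induction on the weight of formulae, that all elements of \<open>M\<close> hold infinitely often and all
  elements of \<open>N\<close> almost always.
\<close>

section \<open>Shifting temporal operators by one position\<close>

lemma until_at_unfold: "until_at P Q t \<longleftrightarrow> Q t \<or> (P t \<and> until_at P Q (Suc t))"
proof
  assume "until_at P Q t"
  then obtain r where r: "r \<ge> t" "Q r" "\<forall>s. t \<le> s \<and> s < r \<longrightarrow> P s"
    by (auto simp: until_at_def)
  then show "Q t \<or> (P t \<and> until_at P Q (Suc t))"
    unfolding until_at_def by (cases "r = t") (auto intro!: exI[of _ r])
next
  assume "Q t \<or> (P t \<and> until_at P Q (Suc t))"
  then show "until_at P Q t"
  proof
    assume "Q t"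
    then show ?thesis
      unfolding until_at_def by (intro exI[of _ t]) auto
  next
    assume P: "P t \<and> until_at P Q (Suc t)"
    then obtain r where r: "r \<ge> Suc t" "Q r" "\<forall>s. Suc t \<le> s \<and> s < r \<longrightarrow> P s"
      by (auto simp: until_at_def)
    have "P s" if "t \<le> s" "s < r" for s
      using P r(3) that by (cases "s = t") auto
    with r(1,2) show ?thesis
      unfolding until_at_def by (intro exI[of _ r]) simp
  qed
qed

lemma wuntil_at_unfold: "wuntil_at P Q t \<longleftrightarrow> Q t \<or> (P t \<and> wuntil_at P Q (Suc t))"
proof -
  have "(\<forall>s\<ge>t. P s) \<longleftrightarrow> P t \<and> (\<forall>s\<ge>Suc t. P s)"
    by (metis Suc_leD not_less_eq_eq order.antisym order.refl)
  then show ?thesis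
    unfolding wuntil_at_def using until_at_unfold[of P Q t] by blast
qed

lemma until_at_shift: "until_at P Q (n + k) \<longleftrightarrow> until_at (\<lambda>s. P (s + k)) (\<lambda>s. Q (s + k)) n"
proof
  assume "until_at P Q (n + k)"
  then obtain r where r: "r \<ge> n + k" "Q r" "\<forall>s. n + k \<le> s \<and> s < r \<longrightarrow> P s"
    by (auto simp: until_at_def)
  then show "until_at (\<lambda>s. P (s + k)) (\<lambda>s. Q (s + k)) n"
    unfolding until_at_def by (intro exI[of _ "r - k"]) auto
next
  assume "until_at (\<lambda>s. P (s + k)) (\<lambda>s. Q (s + k)) n"
  then obtain r where r: "r \<ge> n" "Q (r + k)" "\<forall>s. n \<le> s \<and> s < r \<longrightarrow> P (s + k)"
    by (auto simp: until_at_def)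
  have "P s" if "n + k \<le> s" "s < r + k" for s
    using r(3)[rule_format, of "s - k"] that by (simp add: less_diff_conv2)
  with r(1,2) show "until_at P Q (n + k)"
    unfolding until_at_def by (intro exI[of _ "r + k"]) auto
qed

lemma wuntil_at_shift: "wuntil_at P Q (n + k) \<longleftrightarrow> wuntil_at (\<lambda>s. P (s + k)) (\<lambda>s. Q (s + k)) n"
proof -
  have "P s" if "\<forall>s\<ge>n. P (s + k)" "s \<ge> n + k" for s
    using that(1)[rule_format, of "s - k"] that(2) by simp
  then have "(\<forall>s\<ge>n + k. P s) \<longleftrightarrow> (\<forall>s\<ge>n. P (s + k))"
    by auto
  then show ?thesis
    by (simp add: wuntil_at_def until_at_shift)
qed

lemma since_at_0 [simp]: "since_at P Q 0 \<longleftrightarrow> Q 0"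
  by (simp add: since_at_def)

lemma wsince_at_0 [simp]: "wsince_at P Q 0 \<longleftrightarrow> Q 0 \<or> P 0"
  by (simp add: wsince_at_def)

lemma since_at_Suc: "since_at P Q (Suc n) \<longleftrightarrow> Q (Suc n) \<or> (P (Suc n) \<and> since_at P Q n)"
proof
  assume "since_at P Q (Suc n)"
  then obtain r where r: "r \<le> Suc n" "Q r" "\<forall>s. r < s \<and> s \<le> Suc n \<longrightarrow> P s"
    by (auto simp: since_at_def)
  then show "Q (Suc n) \<or> (P (Suc n) \<and> since_at P Q n)"
    unfolding since_at_def by (cases "r = Suc n") (auto intro!: exI[of _ r])
next
  assume "Q (Suc n) \<or> (P (Suc n) \<and> since_at P Q n)"
  then show "since_at P Q (Suc n)"
  proof
    assume "Q (Suc n)"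
    then show ?thesis
      unfolding since_at_def by (intro exI[of _ "Suc n"]) auto
  next
    assume P: "P (Suc n) \<and> since_at P Q n"
    then obtain r where r: "r \<le> n" "Q r" "\<forall>s. r < s \<and> s \<le> n \<longrightarrow> P s"
      by (auto simp: since_at_def)
    then show ?thesis
      unfolding since_at_def using P by (intro exI[of _ r]) (auto simp: le_Suc_eq)
  qed
qed

lemma wsince_at_Suc: "wsince_at P Q (Suc n) \<longleftrightarrow> Q (Suc n) \<or> (P (Suc n) \<and> wsince_at P Q n)"
  unfolding wsince_at_def using since_at_Suc[of P Q n] by (auto simp: le_Suc_eq)

text \<open>The conditions at position 0 are the weakening conditions of the respective operators.\<close>

lemma since_at_drop_first:
  "since_at P Q (Suc n) \<longleftrightarrow>
    (if Q 0 then wsince_at (\<lambda>s. P (Suc s)) (\<lambda>s. Q (Suc s)) n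
     else since_at (\<lambda>s. P (Suc s)) (\<lambda>s. Q (Suc s)) n)"
  by (induction n) (auto simp: since_at_Suc wsince_at_Suc)

lemma wsince_at_drop_first:
  "wsince_at P Q (Suc n) \<longleftrightarrow>
    (if P 0 \<or> Q 0 then wsince_at (\<lambda>s. P (Suc s)) (\<lambda>s. Q (Suc s)) n
     else since_at (\<lambda>s. P (Suc s)) (\<lambda>s. Q (Suc s)) n)"
  by (induction n) (auto simp: since_at_Suc wsince_at_Suc)

section \<open>Monotonicity, and the passage between weak and strong until\<close>

lemma until_at_mono:
  "until_at P Q t \<Longrightarrow> (\<And>s. P s \<Longrightarrow> P' s) \<Longrightarrow> (\<And>s. Q s \<Longrightarrow> Q' s) \<Longrightarrow> until_at P' Q' t"
  unfolding until_at_def by blast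

lemma wuntil_at_mono:
  "wuntil_at P Q t \<Longrightarrow> (\<And>s. P s \<Longrightarrow> P' s) \<Longrightarrow> (\<And>s. Q s \<Longrightarrow> Q' s) \<Longrightarrow> wuntil_at P' Q' t"
  unfolding wuntil_at_def until_at_def by blast

lemma since_at_mono:
  "since_at P Q t \<Longrightarrow> (\<And>s. P s \<Longrightarrow> P' s) \<Longrightarrow> (\<And>s. Q s \<Longrightarrow> Q' s) \<Longrightarrow> since_at P' Q' t"
  unfolding since_at_def by blast

lemma wsince_at_mono:
  "wsince_at P Q t \<Longrightarrow> (\<And>s. P s \<Longrightarrow> P' s) \<Longrightarrow> (\<And>s. Q s \<Longrightarrow> Q' s) \<Longrightarrow> wsince_at P' Q' t"
  unfolding wsince_at_def since_at_def by blast

lemmas at_mono = until_at_mono wuntil_at_mono since_at_mono wsince_at_mono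

lemma until_at_imp_wuntil_at: "until_at P Q t \<Longrightarrow> wuntil_at P Q t"
  by (simp add: wuntil_at_def)

text \<open>If \<open>P\<close> holds forever, a later until still supplies a position of
  \<open>Q\<close>, and this position also witnesses the until at \<open>t\<close>. This undoes the
  weakening performed by \<open>rewrite_nu\<close>.\<close>

lemma wuntil_at_imp_until_at:
  assumes "wuntil_at P Q t" and "\<exists>s\<ge>t. until_at P Q s"
  shows "until_at P Q t"
  using assms(1) unfolding wuntil_at_def
proof
  assume P: "\<forall>s\<ge>t. P s"
  from assms(2) obtain s r where "t \<le> s" "s \<le> r" "Q r"
    by (auto simp: until_at_def)
  then have "t \<le> r" "Q r"
    by simp_all
  with P show ?thesis
    unfolding until_at_def by blast
qed

text \<open>The second alternative lets the weak until itself persist, not just \<open>P\<close>,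
  because membership in \<open>N\<close> depends on the whole formula persisting.\<close>

lemma wuntil_at_cases:
  assumes "wuntil_at P Q t"
  obtains "until_at P Q t" | "\<forall>s\<ge>t. wuntil_at P Q s"
  using assms unfolding wuntil_at_def by auto

section \<open>Subformulae and rewriting\<close>

lemma subformulae_refl [simp]: "\<psi> \<in> subformulae \<psi>"
  by (cases \<psi>) auto

lemma subformulae_trans: "\<psi> \<in> subformulae \<chi> \<Longrightarrow> \<chi> \<in> subformulae \<phi> \<Longrightarrow> \<psi> \<in> subformulae \<phi>"
  by (induction \<phi>) auto

lemma psf_simps [simp]:
  "psf Top = {}"
  "psf Bot = {}"
  "psf (Prop p) = {}"
  "psf (NProp p) = {}"
  "psf (Next \<psi>) = psf \<psi>"
  "psf (And \<psi> \<xi>) = psf \<psi> \<union> psf \<xi>"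
  "psf (Or \<psi> \<xi>) = psf \<psi> \<union> psf \<xi>"
  "psf (Until \<psi> \<xi>) = psf \<psi> \<union> psf \<xi>"
  "psf (WUntil \<psi> \<xi>) = psf \<psi> \<union> psf \<xi>"
  "psf (Release \<psi> \<xi>) = psf \<psi> \<union> psf \<xi>"
  "psf (SRelease \<psi> \<xi>) = psf \<psi> \<union> psf \<xi>"
  "psf (Yesterday \<psi>) = insert (Yesterday \<psi>) (psf \<psi>)"
  "psf (WYesterday \<psi>) = insert (WYesterday \<psi>) (psf \<psi>)"
  "psf (Since \<psi> \<xi>) = insert (Since \<psi> \<xi>) (psf \<psi> \<union> psf \<xi>)"
  "psf (WSince \<psi> \<xi>) = insert (WSince \<psi> \<xi>) (psf \<psi> \<union> psf \<xi>)"
  "psf (Before \<psi> \<xi>) = insert (Before \<psi> \<xi>) (psf \<psi> \<union> psf \<xi>)"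
  "psf (WBefore \<psi> \<xi>) = insert (WBefore \<psi> \<xi>) (psf \<psi> \<union> psf \<xi>)"
  by (auto simp: psf_def)

lemma psf_subset: "\<psi> \<in> subformulae \<phi> \<Longrightarrow> psf \<psi> \<subseteq> psf \<phi>"
  using subformulae_trans by (auto simp: psf_def)

lemma mu_subset: "\<psi> \<in> subformulae \<phi> \<Longrightarrow> mu \<psi> \<subseteq> mu \<phi>"
  using subformulae_trans by (auto simp: mu_def)

lemma nu_subset: "\<psi> \<in> subformulae \<phi> \<Longrightarrow> nu \<psi> \<subseteq> nu \<phi>"
  using subformulae_trans by (auto simp: nu_def)

lemma subformulae_rewrite:
  "subformulae (rewrite \<phi> C) = (\<lambda>\<psi>. rewrite \<psi> C) ` subformulae \<phi>"
  by (induction \<phi>) (simp_all add: image_Un)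

lemma is_past_rewrite [simp]: "is_past (rewrite \<phi> C) = is_past \<phi>"
  by (cases \<phi>) auto

lemma weight_rewrite [simp]: "weight (rewrite \<phi> C) = weight \<phi>"
  by (induction \<phi>) auto

lemma rewrite_seq_Nil [simp]: "rewrite_seq \<phi> [] = \<phi>"
  by (simp add: rewrite_seq_def)

lemma rewrite_seq_snoc [simp]: "rewrite_seq \<phi> (Cs @ [C]) = rewrite (rewrite_seq \<phi> Cs) C"
  by (simp add: rewrite_seq_def)

lemma subformulae_rewrite_seq:
  "subformulae (rewrite_seq \<phi> Cs) = (\<lambda>\<psi>. rewrite_seq \<psi> Cs) ` subformulae \<phi>"
  by (induction Cs rule: rev_induct) (simp_all add: subformulae_rewrite image_image)

lemma rewrite_seq_simps [simp]:
  "rewrite_seq Top Cs = Top"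
  "rewrite_seq Bot Cs = Bot"
  "rewrite_seq (Prop p) Cs = Prop p"
  "rewrite_seq (NProp p) Cs = NProp p"
  "rewrite_seq (And \<psi> \<xi>) Cs = And (rewrite_seq \<psi> Cs) (rewrite_seq \<xi> Cs)"
  "rewrite_seq (Or \<psi> \<xi>) Cs = Or (rewrite_seq \<psi> Cs) (rewrite_seq \<xi> Cs)"
  "rewrite_seq (Next \<psi>) Cs = Next (rewrite_seq \<psi> Cs)"
  "rewrite_seq (Until \<psi> \<xi>) Cs = Until (rewrite_seq \<psi> Cs) (rewrite_seq \<xi> Cs)"
  "rewrite_seq (WUntil \<psi> \<xi>) Cs = WUntil (rewrite_seq \<psi> Cs) (rewrite_seq \<xi> Cs)"
  "rewrite_seq (Release \<psi> \<xi>) Cs = Release (rewrite_seq \<psi> Cs) (rewrite_seq \<xi> Cs)"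
  "rewrite_seq (SRelease \<psi> \<xi>) Cs = SRelease (rewrite_seq \<psi> Cs) (rewrite_seq \<xi> Cs)"
  by (induction Cs rule: rev_induct; simp)+

text \<open>The strength that results depends on \<open>Cs\<close>; the kind of operator and the
  operands do not.\<close>

lemma rewrite_seq_past:
  "rewrite_seq (Yesterday \<psi>) Cs \<in> {Yesterday (rewrite_seq \<psi> Cs), WYesterday (rewrite_seq \<psi> Cs)}"
  "rewrite_seq (WYesterday \<psi>) Cs \<in> {Yesterday (rewrite_seq \<psi> Cs), WYesterday (rewrite_seq \<psi> Cs)}"
  "rewrite_seq (Since \<psi> \<xi>) Cs \<in>
    {Since (rewrite_seq \<psi> Cs) (rewrite_seq \<xi> Cs), WSince (rewrite_seq \<psi> Cs) (rewrite_seq \<xi> Cs)}"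
  "rewrite_seq (WSince \<psi> \<xi>) Cs \<in>
    {Since (rewrite_seq \<psi> Cs) (rewrite_seq \<xi> Cs), WSince (rewrite_seq \<psi> Cs) (rewrite_seq \<xi> Cs)}"
  "rewrite_seq (Before \<psi> \<xi>) Cs \<in>
    {Before (rewrite_seq \<psi> Cs) (rewrite_seq \<xi> Cs), WBefore (rewrite_seq \<psi> Cs) (rewrite_seq \<xi> Cs)}"
  "rewrite_seq (WBefore \<psi> \<xi>) Cs \<in>
    {Before (rewrite_seq \<psi> Cs) (rewrite_seq \<xi> Cs), WBefore (rewrite_seq \<psi> Cs) (rewrite_seq \<xi> Cs)}"
  by (induction Cs rule: rev_induct; auto)+

text \<open>Each rewriting only resets the strength of past roots, so a whole sequence is determined
  by the final strengths, which \<open>D\<close> records.\<close>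

lemma rewrite_eq_rewrite_seq:
  assumes "\<And>\<theta>. \<theta> \<in> psf \<psi> \<Longrightarrow> \<theta> \<in> D \<longleftrightarrow> rewrite_seq \<theta> Cs = weaken (rewrite_seq \<theta> Cs)"
  shows "rewrite \<psi> D = rewrite_seq \<psi> Cs"
  using assms
proof (induction \<psi>)
  case (Yesterday \<psi>)
  then show ?case
    using rewrite_seq_past(1)[of \<psi> Cs] by auto
next
  case (WYesterday \<psi>)
  then show ?case
    using rewrite_seq_past(2)[of \<psi> Cs] by auto
next
  case (Since \<psi> \<xi>)
  then show ?case
    using rewrite_seq_past(3)[of \<psi> \<xi> Cs] by auto
next
  case (WSince \<psi> \<xi>)
  then show ?case
    using rewrite_seq_past(4)[of \<psi> \<xi> Cs] by auto
next
  case (Before \<psi> \<xi>)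
  then show ?case
    using rewrite_seq_past(5)[of \<psi> \<xi> Cs] by auto
next
  case (WBefore \<psi> \<xi>)
  then show ?case
    using rewrite_seq_past(6)[of \<psi> \<xi> Cs] by auto
qed auto

lemma rewrite_entailed_comp:
  assumes "\<psi> \<in> subformulae \<phi>"
  shows "rewrite \<psi> (entailed_comp \<phi> w t) = rewrite_seq \<psi> (entailed_seq \<phi> w t)"
  using psf_subset[OF assms] by (intro rewrite_eq_rewrite_seq) (auto simp: entailed_comp_def)

lemma entailed_seq_Suc:
  "entailed_seq \<phi> w (Suc t) = entailed_seq \<phi> w t @ [entailed \<phi> w (Suc t)]"
  by (simp add: entailed_seq_def)

lemma entailed_Suc:
  "entailed \<phi> w (Suc t) =
    {\<psi> \<in> psf (rewrite_seq \<phi> (entailed_seq \<phi> w t)). suffix t w \<Turnstile> wc \<psi>}"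
  by (simp add: entailed_seq_def)

text \<open>From here on \<open>entailed_Suc\<close>, phrased with \<open>entailed_seq\<close>,
  replaces the recursive equation.\<close>

declare entailed.simps(2) [simp del]

lemma rewrite_weak_psf:
  assumes "\<And>\<theta>. \<theta> \<in> psf \<psi> \<Longrightarrow> \<theta> \<in> C \<longleftrightarrow> \<theta> = weaken \<theta>"
  shows "rewrite \<psi> C = \<psi>"
  using rewrite_eq_rewrite_seq[of \<psi> C "[]"] assms by simp

text \<open>The initial set marks exactly the past subformulae that are already weak, so rewriting
  by it changes nothing.\<close>

lemma rewrite_seq_entailed_seq_0:
  assumes "\<psi> \<in> subformulae \<phi>"
  shows "rewrite_seq \<psi> (entailed_seq \<phi> w 0) = \<psi>"
proof -
  have "rewrite_seq \<psi> (entailed_seq \<phi> w 0) = rewrite \<psi> (entailed \<phi> w 0)"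
    by (simp add: entailed_seq_def rewrite_seq_def)
  also have "\<dots> = \<psi>"
    using psf_subset[OF assms] by (intro rewrite_weak_psf) auto
  finally show ?thesis .
qed

section \<open>Rewriting by entailed sets replaces the past\<close>

text \<open>Isolates what a single rewriting or after-function step must know about
  \<open>C\<close>, independently of how \<open>C\<close> arises as an entailed set.\<close>

definition past_oracle :: "'a set word \<Rightarrow> 'a pltl \<Rightarrow> 'a pltl set \<Rightarrow> bool" where
  "past_oracle v \<chi> C \<longleftrightarrow> (\<forall>\<theta>\<in>psf \<chi>. \<theta> \<in> C \<longleftrightarrow> v \<Turnstile> wc \<theta>)"

lemma past_oracle_subset: "past_oracle v \<chi> C \<Longrightarrow> psf \<psi> \<subseteq> psf \<chi> \<Longrightarrow> past_oracle v \<psi> C"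
  by (auto simp: past_oracle_def)

lemma past_oracle_simps [simp]:
  "past_oracle v Top C"
  "past_oracle v Bot C"
  "past_oracle v (Prop p) C"
  "past_oracle v (NProp p) C"
  "past_oracle v (Next \<psi>) C \<longleftrightarrow> past_oracle v \<psi> C"
  "past_oracle v (And \<psi> \<xi>) C \<longleftrightarrow> past_oracle v \<psi> C \<and> past_oracle v \<xi> C"
  "past_oracle v (Or \<psi> \<xi>) C \<longleftrightarrow> past_oracle v \<psi> C \<and> past_oracle v \<xi> C"
  "past_oracle v (Until \<psi> \<xi>) C \<longleftrightarrow> past_oracle v \<psi> C \<and> past_oracle v \<xi> C"
  "past_oracle v (WUntil \<psi> \<xi>) C \<longleftrightarrow> past_oracle v \<psi> C \<and> past_oracle v \<xi> C"
  "past_oracle v (Release \<psi> \<xi>) C \<longleftrightarrow> past_oracle v \<psi> C \<and> past_oracle v \<xi> C"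
  "past_oracle v (SRelease \<psi> \<xi>) C \<longleftrightarrow> past_oracle v \<psi> C \<and> past_oracle v \<xi> C"
  "past_oracle v (Yesterday \<psi>) C \<longleftrightarrow> (Yesterday \<psi> \<in> C \<longleftrightarrow> v \<Turnstile> \<psi>) \<and> past_oracle v \<psi> C"
  "past_oracle v (WYesterday \<psi>) C \<longleftrightarrow> (WYesterday \<psi> \<in> C \<longleftrightarrow> v \<Turnstile> \<psi>) \<and> past_oracle v \<psi> C"
  "past_oracle v (Since \<psi> \<xi>) C \<longleftrightarrow>
    (Since \<psi> \<xi> \<in> C \<longleftrightarrow> v \<Turnstile> wc (Since \<psi> \<xi>)) \<and> past_oracle v \<psi> C \<and> past_oracle v \<xi> C"
  "past_oracle v (WSince \<psi> \<xi>) C \<longleftrightarrow>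
    (WSince \<psi> \<xi> \<in> C \<longleftrightarrow> v \<Turnstile> wc (WSince \<psi> \<xi>)) \<and> past_oracle v \<psi> C \<and> past_oracle v \<xi> C"
  "past_oracle v (Before \<psi> \<xi>) C \<longleftrightarrow>
    (Before \<psi> \<xi> \<in> C \<longleftrightarrow> v \<Turnstile> wc (Before \<psi> \<xi>)) \<and> past_oracle v \<psi> C \<and> past_oracle v \<xi> C"
  "past_oracle v (WBefore \<psi> \<xi>) C \<longleftrightarrow>
    (WBefore \<psi> \<xi> \<in> C \<longleftrightarrow> v \<Turnstile> wc (WBefore \<psi> \<xi>)) \<and> past_oracle v \<psi> C \<and> past_oracle v \<xi> C"
  by (auto simp: past_oracle_def)

text \<open>Once the first letter is dropped, its only trace in a past operator is whether the
  weakening condition held there, and the strength of the rewritten root stores this. The position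
  \<open>n\<close> is arbitrary since temporal operators evaluate their operands elsewhere.\<close>

lemma sat_rewrite:
  assumes "past_oracle v \<chi> C"
  shows "sat v (Suc n) \<chi> \<longleftrightarrow> sat (suffix 1 v) n (rewrite \<chi> C)"
  using assms
proof (induction \<chi> arbitrary: n)
  case (Until \<psi> \<xi>)
  then show ?case
    using until_at_shift[of _ _ n 1] by auto
next
  case (WUntil \<psi> \<xi>)
  then show ?case
    using wuntil_at_shift[of _ _ n 1] by auto
next
  case (Release \<psi> \<xi>)
  then show ?case
    using wuntil_at_shift[of _ _ n 1] by auto
next
  case (SRelease \<psi> \<xi>)
  then show ?case
    using until_at_shift[of _ _ n 1] by auto
next
  \<comment> \<open>The strength matters only for \<open>n = 0\<close>, where the suffix has no
    previous position.\<close>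
  case (Yesterday \<psi>)
  then show ?case
    by (cases n) auto
next
  case (WYesterday \<psi>)
  then show ?case
    by (cases n) auto
next
  case (Since \<psi> \<xi>)
  then show ?case
    by (auto simp: since_at_drop_first)
next
  case (WSince \<psi> \<xi>)
  then show ?case
    by (auto simp: wsince_at_drop_first)
next
  case (Before \<psi> \<xi>)
  then show ?case
    by (auto simp: since_at_drop_first)
next
  case (WBefore \<psi> \<xi>)
  then show ?case
    by (auto simp: wsince_at_drop_first)
qed auto

text \<open>An inclusion suffices as hypothesis, so that this covers both rewritten subformulae of
  \<open>\<phi>\<close> and the formulae reached by the after-function.\<close>

lemma past_oracle_entailed:
  assumes "psf \<chi> \<subseteq> psf (rewrite_seq \<phi> (entailed_seq \<phi> w t))"
  shows "past_oracle (suffix t w) \<chi> (entailed \<phi> w (Suc t))"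
  using assms by (auto simp: past_oracle_def entailed_Suc)

text \<open>Each step of the induction drops one letter by \<open>sat_rewrite\<close>; the induction
  hypothesis is then needed at \<open>Suc n\<close>.\<close>

lemma sat_rewrite_entailed_seq:
  assumes "\<psi> \<in> subformulae \<phi>"
  shows "sat (suffix t w) n (rewrite_seq \<psi> (entailed_seq \<phi> w t)) \<longleftrightarrow> sat w (t + n) \<psi>"
proof (induction t arbitrary: n)
  case 0
  then show ?case
    by (simp add: rewrite_seq_entailed_seq_0[OF assms])
next
  case (Suc t)
  let ?\<chi> = "rewrite_seq \<psi> (entailed_seq \<phi> w t)"
  have "?\<chi> \<in> subformulae (rewrite_seq \<phi> (entailed_seq \<phi> w t))"
    using assms by (simp add: subformulae_rewrite_seq)
  from sat_rewrite[OF past_oracle_entailed[OF psf_subset[OF this]], of n] Suc[of "Suc n"]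
  show ?case
    by (simp add: entailed_seq_Suc suffix_def)
qed

lemma sat_rewrite_entailed_comp:
  assumes "\<psi> \<in> subformulae \<phi>"
  shows "sat (suffix t w) n (rewrite \<psi> (entailed_comp \<phi> w t)) \<longleftrightarrow> sat w (t + n) \<psi>"
  using assms by (simp add: rewrite_entailed_comp sat_rewrite_entailed_seq)

section \<open>Correctness of the local after-function\<close>

lemma psf_wc: "psf (wc \<psi>) \<subseteq> psf \<psi>"
  by (cases \<psi>) auto

text \<open>Across the first letter of \<open>v\<close>, \<open>af\<close> transports truth at
  position 0 and \<open>pu\<close> truth at position 1. Unfolding reduces a future operator to these
  two, and at position 0 a binary past operator coincides with its weakening condition.\<close>

lemma sat_af_pu:
  shows "past_oracle v \<chi> C \<Longrightarrow> \<sigma> = v 0 \<Longrightarrow> suffix 1 v \<Turnstile> af \<chi> \<sigma> C \<longleftrightarrow> v \<Turnstile> \<chi>"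
    and "past_oracle v \<chi> C \<Longrightarrow> \<sigma> = v 0 \<Longrightarrow> suffix 1 v \<Turnstile> pu \<chi> \<sigma> C \<longleftrightarrow> sat v 1 \<chi>"
proof (induction \<chi> \<sigma> C and \<chi> \<sigma> C rule: af_pu.induct)
  case (7 \<psi> \<sigma> C)
  then show ?case
    by (simp del: pu.simps)
next
  case (8 \<psi> \<xi> \<sigma> C)
  then show ?case
    using until_at_unfold[of "\<lambda>s. sat v s \<psi>" "\<lambda>s. sat v s \<xi>" 0]
    by (auto simp del: pu.simps)
next
  case (9 \<psi> \<xi> \<sigma> C)
  then show ?case
    using wuntil_at_unfold[of "\<lambda>s. sat v s \<psi>" "\<lambda>s. sat v s \<xi>" 0]
    by (auto simp del: pu.simps)
next
  case (10 \<psi> \<xi> \<sigma> C)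
  then show ?case
    using wuntil_at_unfold[of "\<lambda>s. sat v s \<xi>" "\<lambda>s. sat v s \<psi> \<and> sat v s \<xi>" 0]
    by (auto simp del: pu.simps)
next
  case (11 \<psi> \<xi> \<sigma> C)
  then show ?case
    using until_at_unfold[of "\<lambda>s. sat v s \<xi>" "\<lambda>s. sat v s \<psi> \<and> sat v s \<xi>" 0]
    by (auto simp del: pu.simps)
next
  case (18 \<chi> \<sigma> C)
  \<comment> \<open>Every conjunct added by \<open>pu\<close> is true: the oracle admits into
    \<open>C\<close> only formulae whose weakening condition holds. Hence \<open>pu\<close> is
    equivalent here to the rewritten formula alone.\<close>
  have "suffix 1 v \<Turnstile> af (wc \<psi>) \<sigma> C" if "\<psi> \<in> psf \<chi> \<inter> C" for \<psi>
  proof -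
    have "psf (wc \<psi>) \<subseteq> psf \<chi>"
      using that psf_wc[of \<psi>] psf_subset[of \<psi> \<chi>] by (auto simp: psf_def)
    then have "past_oracle v (wc \<psi>) C"
      using past_oracle_subset "18.prems"(1) by blast
    moreover have "v \<Turnstile> wc \<psi>"
      using that "18.prems"(1) unfolding past_oracle_def by blast
    ultimately show ?thesis
      using "18.IH"[OF that] "18.prems"(2) by blast
  qed
  then have "suffix 1 v \<Turnstile> Conj ((\<lambda>\<psi>. af (wc \<psi>) \<sigma> C) ` (psf \<chi> \<inter> C))"
    by (subst sat_Conj) (simp_all add: finite_psf)
  moreover have "sat v 1 \<chi> \<longleftrightarrow> suffix 1 v \<Turnstile> rewrite \<chi> C"
    using sat_rewrite[OF "18.prems"(1), of 0] by simp
  ultimately show ?case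
    by (simp only: pu.simps sat.simps simp_thms)
qed auto

text \<open>The after-function introduces neither past nor \<open>\<mu>\<close>-formulae beyond the rewritten ones:
  for the former, the entailed sets of \<open>\<phi>\<close> remain correct for the formulae reached from \<open>\<phi>\<close>;
  for the latter, rewriting by \<open>M\<close> commutes with the after-function.\<close>

definition core :: "'a pltl \<Rightarrow> 'a pltl set" where
  "core \<phi> = psf \<phi> \<union> mu \<phi>"

lemma core_trans: "\<psi> \<in> subformulae \<phi> \<Longrightarrow> core \<psi> \<subseteq> core \<phi>"
  unfolding core_def using psf_subset mu_subset by blast

lemma core_simps [simp]:
  "core Top = {}"
  "core Bot = {}"
  "core (Prop p) = {}"
  "core (NProp p) = {}"
  "core (And \<psi> \<xi>) = core \<psi> \<union> core \<xi>"
  "core (Or \<psi> \<xi>) = core \<psi> \<union> core \<xi>"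
  "core (Next \<psi>) = core \<psi>"
  "core (Until \<psi> \<xi>) = insert (Until \<psi> \<xi>) (core \<psi> \<union> core \<xi>)"
  "core (WUntil \<psi> \<xi>) = core \<psi> \<union> core \<xi>"
  "core (Release \<psi> \<xi>) = core \<psi> \<union> core \<xi>"
  "core (SRelease \<psi> \<xi>) = insert (SRelease \<psi> \<xi>) (core \<psi> \<union> core \<xi>)"
  "core (Yesterday \<psi>) = insert (Yesterday \<psi>) (core \<psi>)"
  "core (WYesterday \<psi>) = insert (WYesterday \<psi>) (core \<psi>)"
  "core (Since \<psi> \<xi>) = insert (Since \<psi> \<xi>) (core \<psi> \<union> core \<xi>)"
  "core (WSince \<psi> \<xi>) = insert (WSince \<psi> \<xi>) (core \<psi> \<union> core \<xi>)"
  "core (Before \<psi> \<xi>) = insert (Before \<psi> \<xi>) (core \<psi> \<union> core \<xi>)"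
  "core (WBefore \<psi> \<xi>) = insert (WBefore \<psi> \<xi>) (core \<psi> \<union> core \<xi>)"
  by (auto simp: core_def psf_def mu_def)

lemma core_Conj:
  assumes "finite A"
  shows "core (Conj A) = (\<Union>\<psi>\<in>A. core \<psi>)"
proof -
  define xs where "xs = (SOME xs. distinct xs \<and> set xs = A)"
  have "\<exists>xs. distinct xs \<and> set xs = A"
    using finite_distinct_list[OF assms] by blast
  then have "set xs = A"
    unfolding xs_def by (rule someI2_ex) simp
  moreover have "core (foldr And ys Top) = (\<Union>\<psi>\<in>set ys. core \<psi>)" for ys :: "'a pltl list"
    by (induction ys) auto
  ultimately show ?thesis
    unfolding Conj_def xs_def by blast
qed

text \<open>On past formulae, \<open>wc\<close> yields an operand or joins both operands by
  \<open>And\<close> or \<open>Or\<close>, which contribute nothing to \<open>core\<close>.\<close>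

lemma core_rewrite_wc: "core (rewrite (wc \<psi>) C) \<subseteq> core (rewrite \<psi> C)"
  by (cases \<psi>) auto

text \<open>The bound refers to the rewritten formula because \<open>pu\<close> inserts
  \<open>rewrite \<chi> C\<close> itself; everything else stems from operands and weakening
  conditions.\<close>

lemma core_af_pu:
  shows "core (af \<chi> \<sigma> C) \<subseteq> core (rewrite \<chi> C)"
    and "core (pu \<chi> \<sigma> C) \<subseteq> core (rewrite \<chi> C)"
proof (induction \<chi> \<sigma> C and \<chi> \<sigma> C rule: af_pu.induct)
  case (18 \<chi> \<sigma> C)
  have "core (af (wc \<psi>) \<sigma> C) \<subseteq> core (rewrite \<chi> C)" if "\<psi> \<in> psf \<chi> \<inter> C" for \<psi>
  proof -
    have "core (af (wc \<psi>) \<sigma> C) \<subseteq> core (rewrite \<psi> C)"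
      using 18 that core_rewrite_wc by fast
    also have "\<dots> \<subseteq> core (rewrite \<chi> C)"
      using that by (intro core_trans) (auto simp: psf_def subformulae_rewrite)
    finally show ?thesis .
  qed
  then show ?case
    by (auto simp: core_Conj finite_psf)
qed (auto simp del: pu.simps)

section \<open>Images of the subformula sets under rewriting\<close>

lemma psf_rewrite: "psf (rewrite \<phi> C) = (\<lambda>\<psi>. rewrite \<psi> C) ` psf \<phi>"
  by (auto simp: psf_def subformulae_rewrite)

lemma mu_root_rewrite:
  "(\<exists>\<alpha> \<beta>. rewrite \<psi> C = Until \<alpha> \<beta> \<or> rewrite \<psi> C = SRelease \<alpha> \<beta>) \<longleftrightarrow>
   (\<exists>\<alpha> \<beta>. \<psi> = Until \<alpha> \<beta> \<or> \<psi> = SRelease \<alpha> \<beta>)"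
  by (cases \<psi>) auto

lemma nu_root_rewrite:
  "(\<exists>\<alpha> \<beta>. rewrite \<psi> C = WUntil \<alpha> \<beta> \<or> rewrite \<psi> C = Release \<alpha> \<beta>) \<longleftrightarrow>
   (\<exists>\<alpha> \<beta>. \<psi> = WUntil \<alpha> \<beta> \<or> \<psi> = Release \<alpha> \<beta>)"
  by (cases \<psi>) auto

lemma mu_rewrite: "mu (rewrite \<phi> C) = (\<lambda>\<psi>. rewrite \<psi> C) ` mu \<phi>"
  unfolding mu_def subformulae_rewrite by (auto simp only: Compr_image_eq mu_root_rewrite)

lemma nu_rewrite: "nu (rewrite \<phi> C) = (\<lambda>\<psi>. rewrite \<psi> C) ` nu \<phi>"
  unfolding nu_def subformulae_rewrite by (auto simp only: Compr_image_eq nu_root_rewrite)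

lemma core_rewrite: "core (rewrite \<phi> C) = (\<lambda>\<psi>. rewrite \<psi> C) ` core \<phi>"
  by (simp add: core_def psf_rewrite mu_rewrite image_Un)

section \<open>The after-function along a prefix\<close>

abbreviation af_prefix :: "'a pltl \<Rightarrow> 'a set word \<Rightarrow> nat \<Rightarrow> 'a pltl" where
  "af_prefix \<phi> w r \<equiv> af_seq \<phi> (prefix r w) (entailed_seq \<phi> w r)"

lemma af_prefix_0: "af_prefix \<phi> w 0 = \<phi>"
  by (simp add: af_seq_def)

lemma af_prefix_Suc: "af_prefix \<phi> w (Suc r) = af (af_prefix \<phi> w r) (w r) (entailed \<phi> w (Suc r))"
proof -
  \<comment> \<open>\<open>entailed_seq \<phi> w r\<close> has \<open>r + 1\<close> entries, so its
    tail matches the prefix of length \<open>r\<close>, and the new letter and set form exactly one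
    further pair of the \<open>zip\<close>.\<close>
  have "tl (entailed_seq \<phi> w (Suc r)) = tl (entailed_seq \<phi> w r) @ [entailed \<phi> w (Suc r)]"
    by (subst entailed_seq_Suc, subst tl_append2) (simp_all add: entailed_seq_def)
  moreover have "length (tl (entailed_seq \<phi> w r)) = length (prefix r w)"
    by (simp add: entailed_seq_def)
  ultimately show ?thesis
    by (simp add: af_seq_def)
qed

lemma core_af_prefix: "core (af_prefix \<phi> w r) \<subseteq> core (rewrite_seq \<phi> (entailed_seq \<phi> w r))"
proof (induction r)
  case 0
  then show ?case
    by (simp only: af_prefix_0 rewrite_seq_entailed_seq_0[OF subformulae_refl] order.refl)
next
  case (Suc r)
  let ?C = "entailed \<phi> w (Suc r)"
  have "core (af_prefix \<phi> w (Suc r)) \<subseteq> core (rewrite (af_prefix \<phi> w r) ?C)"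
    unfolding af_prefix_Suc by (rule core_af_pu)
  also have "\<dots> \<subseteq> core (rewrite (rewrite_seq \<phi> (entailed_seq \<phi> w r)) ?C)"
    unfolding core_rewrite using Suc by blast
  finally show ?case
    by (simp add: entailed_seq_Suc)
qed

lemma psf_core: "psf \<phi> = {\<psi> \<in> core \<phi>. is_past \<psi>}"
  by (auto simp: core_def psf_def mu_def)

lemma mu_core: "mu \<phi> = {\<psi> \<in> core \<phi>. \<exists>\<alpha> \<beta>. \<psi> = Until \<alpha> \<beta> \<or> \<psi> = SRelease \<alpha> \<beta>}"
  by (auto simp: core_def psf_def mu_def)

text \<open>The bound on \<open>core\<close> keeps the entailed sets of \<open>\<phi>\<close> a
  correct oracle for the formula reached, so \<open>sat_af_pu\<close> applies letter by
  letter.\<close>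

lemma sat_af_prefix: "suffix r w \<Turnstile> af_prefix \<phi> w r \<longleftrightarrow> w \<Turnstile> \<phi>"
proof (induction r)
  case 0
  then show ?case
    by (simp add: af_seq_def)
next
  case (Suc r)
  have "psf (af_prefix \<phi> w r) \<subseteq> psf (rewrite_seq \<phi> (entailed_seq \<phi> w r))"
    using core_af_prefix unfolding psf_core by blast
  from sat_af_pu(1)[OF past_oracle_entailed[OF this], of "w r"] Suc show ?case
    unfolding af_prefix_Suc by (simp add: suffix_def)
qed

text \<open>Allows facts about the \<mu>-subformulae of \<open>\<phi>\<close> to be used for the
  formula reached.\<close>

lemma mu_af_prefix: "mu (af_prefix \<phi> w r) \<subseteq> rewrite_set (mu \<phi>) (entailed_comp \<phi> w r)"
proof -
  have "mu (af_prefix \<phi> w r) \<subseteq> mu (rewrite \<phi> (entailed_comp \<phi> w r))"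
    using core_af_prefix unfolding mu_core rewrite_entailed_comp[OF subformulae_refl] by blast
  then show ?thesis
    by (simp add: mu_rewrite rewrite_set_def)
qed

section \<open>The limit rewritings\<close>

lemma mu_simps [simp]:
  "mu Top = {}"
  "mu Bot = {}"
  "mu (Prop p) = {}"
  "mu (NProp p) = {}"
  "mu (And \<psi> \<xi>) = mu \<psi> \<union> mu \<xi>"
  "mu (Or \<psi> \<xi>) = mu \<psi> \<union> mu \<xi>"
  "mu (Next \<psi>) = mu \<psi>"
  "mu (Until \<psi> \<xi>) = insert (Until \<psi> \<xi>) (mu \<psi> \<union> mu \<xi>)"
  "mu (WUntil \<psi> \<xi>) = mu \<psi> \<union> mu \<xi>"
  "mu (Release \<psi> \<xi>) = mu \<psi> \<union> mu \<xi>"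
  "mu (SRelease \<psi> \<xi>) = insert (SRelease \<psi> \<xi>) (mu \<psi> \<union> mu \<xi>)"
  "mu (Yesterday \<psi>) = mu \<psi>"
  "mu (WYesterday \<psi>) = mu \<psi>"
  "mu (Since \<psi> \<xi>) = mu \<psi> \<union> mu \<xi>"
  "mu (WSince \<psi> \<xi>) = mu \<psi> \<union> mu \<xi>"
  "mu (Before \<psi> \<xi>) = mu \<psi> \<union> mu \<xi>"
  "mu (WBefore \<psi> \<xi>) = mu \<psi> \<union> mu \<xi>"
  by (auto simp: mu_def)

lemma nu_simps [simp]:
  "nu Top = {}"
  "nu Bot = {}"
  "nu (Prop p) = {}"
  "nu (NProp p) = {}"
  "nu (And \<psi> \<xi>) = nu \<psi> \<union> nu \<xi>"
  "nu (Or \<psi> \<xi>) = nu \<psi> \<union> nu \<xi>"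
  "nu (Next \<psi>) = nu \<psi>"
  "nu (Until \<psi> \<xi>) = nu \<psi> \<union> nu \<xi>"
  "nu (WUntil \<psi> \<xi>) = insert (WUntil \<psi> \<xi>) (nu \<psi> \<union> nu \<xi>)"
  "nu (Release \<psi> \<xi>) = insert (Release \<psi> \<xi>) (nu \<psi> \<union> nu \<xi>)"
  "nu (SRelease \<psi> \<xi>) = nu \<psi> \<union> nu \<xi>"
  "nu (Yesterday \<psi>) = nu \<psi>"
  "nu (WYesterday \<psi>) = nu \<psi>"
  "nu (Since \<psi> \<xi>) = nu \<psi> \<union> nu \<xi>"
  "nu (WSince \<psi> \<xi>) = nu \<psi> \<union> nu \<xi>"
  "nu (Before \<psi> \<xi>) = nu \<psi> \<union> nu \<xi>"
  "nu (WBefore \<psi> \<xi>) = nu \<psi> \<union> nu \<xi>"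
  by (auto simp: nu_def)

lemma until_at_True [simp]: "until_at (\<lambda>s. True) Q t \<longleftrightarrow> (\<exists>s\<ge>t. Q s)"
  by (simp add: until_at_def)

lemma wuntil_at_False [simp]: "wuntil_at P (\<lambda>s. False) t \<longleftrightarrow> (\<forall>s\<ge>t. P s)"
  by (simp add: wuntil_at_def until_at_def)

text \<open>A \<mu>-subformula replaced by \<open>Bot\<close> is nowhere true in \<open>v\<close>;
  those in \<open>M\<close> are merely weakened.\<close>

lemma sat_imp_sat_rewrite_nu:
  assumes "\<And>\<psi> n. \<psi> \<in> mu \<chi> \<Longrightarrow> sat v n \<psi> \<Longrightarrow> \<psi> \<in> M"
  shows "sat v n \<chi> \<Longrightarrow> sat v n (\<chi>[M]\<^sub>\<nu>)"
  using assms
proof (induction \<chi> arbitrary: n)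
  case (Until \<psi> \<xi>)
  then have "Until \<psi> \<xi> \<in> M"
    by (metis insertI1 mu_simps(8))
  with Until show ?case
    by (auto intro!: until_at_imp_wuntil_at elim!: at_mono)
next
  case (SRelease \<psi> \<xi>)
  then have "SRelease \<psi> \<xi> \<in> M"
    by (metis insertI1 mu_simps(11))
  with SRelease show ?case
    by (auto intro!: until_at_imp_wuntil_at elim!: at_mono)
qed (auto elim!: at_mono)

text \<open>The weakened formulae recur forever, so their weak versions already imply the strong
  ones.\<close>

lemma sat_rewrite_nu_imp_sat:
  assumes "\<And>\<psi> n. \<psi> \<in> mu \<chi> \<Longrightarrow> \<psi> \<in> M \<Longrightarrow> \<exists>m\<ge>n. sat v m \<psi>"
  shows "sat v n (\<chi>[M]\<^sub>\<nu>) \<Longrightarrow> sat v n \<chi>"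
  using assms
proof (induction \<chi> arbitrary: n)
  case (Until \<psi> \<xi>)
  then have M: "Until \<psi> \<xi> \<in> M"
    by (auto split: if_splits)
  then have "\<exists>m\<ge>n. sat v m (Until \<psi> \<xi>)"
    using Until.prems(2) by (metis insertI1 mu_simps(8))
  moreover have "sat v n (WUntil \<psi> \<xi>)"
    using M Until by (auto elim!: at_mono)
  ultimately show ?case
    by (simp add: wuntil_at_imp_until_at)
next
  case (SRelease \<psi> \<xi>)
  then have M: "SRelease \<psi> \<xi> \<in> M"
    by (auto split: if_splits)
  then have "\<exists>m\<ge>n. sat v m (SRelease \<psi> \<xi>)"
    using SRelease.prems(2) by (metis insertI1 mu_simps(11))
  moreover have "sat v n (Release \<psi> \<xi>)"
    using M SRelease by (auto elim!: at_mono)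
  ultimately show ?case
    by (simp add: wuntil_at_imp_until_at)
qed (auto elim!: at_mono)

text \<open>A \<nu>-subformula outside \<open>N\<close> fails again after every position, so
  wherever it holds it must hold in its strong version.\<close>

lemma sat_imp_sat_rewrite_mu:
  assumes "\<And>\<psi> n. \<psi> \<in> nu \<chi> \<Longrightarrow> \<forall>m\<ge>n. sat v m \<psi> \<Longrightarrow> \<psi> \<in> N"
  shows "sat v n \<chi> \<Longrightarrow> sat v n (\<chi>[N]\<^sub>\<mu>)"
  using assms
proof (induction \<chi> arbitrary: n)
  case (WUntil \<psi> \<xi>)
  show ?case
  proof (cases "WUntil \<psi> \<xi> \<in> N")
    case False
    then have "\<not> (\<forall>m\<ge>n. sat v m (WUntil \<psi> \<xi>))"
      using WUntil.prems(2) by fastforce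
    then have "sat v n (Until \<psi> \<xi>)"
      using WUntil.prems(1) by (auto elim: wuntil_at_cases)
    with False WUntil show ?thesis
      by (auto elim!: at_mono)
  qed simp
next
  case (Release \<psi> \<xi>)
  show ?case
  proof (cases "Release \<psi> \<xi> \<in> N")
    case False
    then have "\<not> (\<forall>m\<ge>n. sat v m (Release \<psi> \<xi>))"
      using Release.prems(2) by fastforce
    then have "sat v n (SRelease \<psi> \<xi>)"
      using Release.prems(1) by (auto elim: wuntil_at_cases)
    with False Release show ?thesis
      by (auto elim!: at_mono)
  qed simp
qed (auto elim!: at_mono)

text \<open>Only the replacement by \<open>Top\<close> could add models, and formulae in
  \<open>N\<close> hold throughout \<open>v\<close>.\<close>

lemma sat_rewrite_mu_imp_sat:
  assumes "\<And>\<psi> n. \<psi> \<in> nu \<chi> \<Longrightarrow> \<psi> \<in> N \<Longrightarrow> sat v n \<psi>"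
  shows "sat v n (\<chi>[N]\<^sub>\<mu>) \<Longrightarrow> sat v n \<chi>"
  using assms
proof (induction \<chi> arbitrary: n)
  case (WUntil \<psi> \<xi>)
  show ?case
  proof (cases "WUntil \<psi> \<xi> \<in> N")
    case True
    with WUntil.prems(2) show ?thesis
      by (metis insertI1 nu_simps(9))
  next
    case False
    with WUntil show ?thesis
      by (auto intro!: until_at_imp_wuntil_at elim!: at_mono)
  qed
next
  case (Release \<psi> \<xi>)
  show ?case
  proof (cases "Release \<psi> \<xi> \<in> N")
    case True
    with Release.prems(2) show ?thesis
      by (metis insertI1 nu_simps(10))
  next
    case False
    with Release show ?thesis
      by (auto intro!: until_at_imp_wuntil_at elim!: at_mono)
  qed
qed (auto elim!: at_mono)

section \<open>The characterisation\<close>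

lemma weight_subformula_strict:
  assumes "\<psi> \<in> subformulae \<phi>" and "\<psi> \<noteq> \<phi>"
  shows "weight \<psi> < weight \<phi>"
  using assms by (cases \<phi>) (auto dest!: weight_subformula)

text \<open>The roots of \<open>\<psi>\<close> and \<open>\<chi>\<close> are different operators, so
  \<open>\<chi>\<close> is a proper subformula. With the dual fact below, this makes the induction
  alternating between \<open>M\<close> and \<open>N\<close> well-founded.\<close>

lemma weight_nu_less:
  assumes "\<psi> \<in> mu \<phi>" and "\<chi> \<in> nu \<psi>"
  shows "weight \<chi> < weight \<psi>"
  using assms by (intro weight_subformula_strict) (auto simp: mu_def nu_def)

lemma weight_mu_less:
  assumes "\<psi> \<in> nu \<phi>" and "\<chi> \<in> mu \<psi>"
  shows "weight \<chi> < weight \<psi>"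
  using assms by (intro weight_subformula_strict) (auto simp: mu_def nu_def)

theorem theorem19:
  fixes \<phi> :: "'a pltl" and w :: "'a set word" and r :: nat
  assumes "\<And>i. w i \<subseteq> vars \<phi>"
    and "stable w \<phi> r"
  shows "w \<Turnstile> \<phi> \<longleftrightarrow>
    (\<exists>M N. M \<subseteq> mu \<phi> \<and> N \<subseteq> nu \<phi> \<and>
      suffix r w \<Turnstile> rewrite_nu (af_seq \<phi> (prefix r w) (entailed_seq \<phi> w r))
                        (rewrite_set M (entailed_comp \<phi> w r)) \<and>
      (\<forall>\<psi>\<in>M. \<forall>s. \<exists>t\<ge>s. suffix t w \<Turnstile>
        Finally (rewrite_mu (rewrite \<psi> (entailed_comp \<phi> w t))
                   (rewrite_set N (entailed_comp \<phi> w t)))) \<and>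
      (\<forall>\<psi>\<in>N. \<exists>t\<ge>0. suffix t w \<Turnstile>
        Globally (rewrite_nu (rewrite \<psi> (entailed_comp \<phi> w t))
                   (rewrite_set M (entailed_comp \<phi> w t)))))"
    (is "_ \<longleftrightarrow> (\<exists>M N. ?char M N)")
proof
  let ?D = "entailed_comp \<phi> w"
  define M where "M = {\<psi> \<in> mu \<phi>. \<forall>s. \<exists>t\<ge>s. sat w t \<psi>}"
  define N where "N = {\<psi> \<in> nu \<phi>. \<exists>s. \<forall>t\<ge>s. sat w t \<psi>}"
  have mu_subf: "mu \<phi> \<subseteq> subformulae \<phi>" and nu_subf: "nu \<phi> \<subseteq> subformulae \<phi>"
    by (auto simp: mu_def nu_def)
  \<comment> \<open>First half of stability: one occurrence at or after \<open>r\<close> already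
    forces infinitely many.\<close>
  have in_M: "\<theta> \<in> M" if \<theta>: "\<theta> \<in> mu \<phi>" "sat w t \<theta>" "t \<ge> r" for \<theta> t
  proof -
    have "sat w r (Globally (Finally \<theta>))"
      using assms(2) \<theta> unfolding stable_def by auto
    then show ?thesis
      using \<theta>(1) unfolding M_def by simp (meson nle_le order.trans)
  qed
  \<comment> \<open>Second half of stability: what holds almost always holds from \<open>r\<close>
    on.\<close>
  have N_holds: "sat w t \<theta>" if \<theta>: "\<theta> \<in> N" "t \<ge> r" for \<theta> t
  proof -
    from \<theta>(1) obtain s where s: "\<forall>t\<ge>s. sat w t \<theta>" and nu: "\<theta> \<in> nu \<phi>"
      by (auto simp: N_def)
    then have "sat w r (Finally (Globally \<theta>))"
      by (auto intro!: exI[of _ "max r s"])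
    then have "sat w r (Globally \<theta>)"
      using assms(2) nu unfolding stable_def by blast
    with \<theta>(2) show ?thesis
      by simp
  qed
  \<comment> \<open>Kept general in \<open>\<chi>\<close> to serve both the formula reached by the
    after-function and the rewritten elements of \<open>N\<close>.\<close>
  have nu_r: "sat (suffix r w) n (\<chi>[rewrite_set M (?D r)]\<^sub>\<nu>)"
    if \<chi>: "mu \<chi> \<subseteq> rewrite_set (mu \<phi>) (?D r)" "sat (suffix r w) n \<chi>" for \<chi> n
  proof (rule sat_imp_sat_rewrite_nu[OF _ \<chi>(2)])
    fix \<psi> m
    assume \<psi>: "\<psi> \<in> mu \<chi>" "sat (suffix r w) m \<psi>"
    obtain \<theta> where \<theta>: "\<theta> \<in> mu \<phi>" "\<psi> = rewrite \<theta> (?D r)"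
      using \<chi>(1) \<psi>(1) unfolding rewrite_set_def by blast
    with \<psi> mu_subf have "sat w (r + m) \<theta>"
      by (metis sat_rewrite_entailed_comp subsetD)
    from in_M[OF \<theta>(1) this] have "\<theta> \<in> M"
      by simp
    with \<theta>(2) show "\<psi> \<in> rewrite_set M (?D r)"
      by (simp add: rewrite_set_def)
  qed
  assume "w \<Turnstile> \<phi>"
  then have "suffix r w \<Turnstile> (af_prefix \<phi> w r)[rewrite_set M (?D r)]\<^sub>\<nu>"
    by (intro nu_r mu_af_prefix) (simp add: sat_af_prefix)
  moreover have "\<exists>t\<ge>s. suffix t w \<Turnstile> Finally ((rewrite \<psi> (?D t))[rewrite_set N (?D t)]\<^sub>\<mu>)"
    if "\<psi> \<in> M" for \<psi> s
  proof -
    from that obtain t where t: "t \<ge> s" "sat w t \<psi>" and \<psi>: "\<psi> \<in> mu \<phi>"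
      by (auto simp: M_def)
    have "suffix t w \<Turnstile> (rewrite \<psi> (?D t))[rewrite_set N (?D t)]\<^sub>\<mu>"
    proof (rule sat_imp_sat_rewrite_mu)
      show "suffix t w \<Turnstile> rewrite \<psi> (?D t)"
        using t \<psi> mu_subf by (subst sat_rewrite_entailed_comp) auto
      fix \<chi> n
      assume \<chi>: "\<chi> \<in> nu (rewrite \<psi> (?D t))" "\<forall>m\<ge>n. sat (suffix t w) m \<chi>"
      then obtain \<theta> where \<theta>: "\<theta> \<in> nu \<psi>" "\<chi> = rewrite \<theta> (?D t)"
        by (auto simp: nu_rewrite)
      then have "\<theta> \<in> nu \<phi>"
        using \<psi> nu_subset mu_subf by blast
      \<comment> \<open>Truth from position \<open>n\<close> of the suffix on means truth in
        \<open>w\<close> from \<open>t + n\<close> on, which is what \<open>N\<close> asks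
        for.\<close>
      moreover have "sat w m \<theta>" if "m \<ge> t + n" for m
      proof -
        have "sat (suffix t w) (m - t) \<chi>"
          using \<chi>(2) that by simp
        then show ?thesis
          using that \<theta> \<open>\<theta> \<in> nu \<phi>\<close> nu_subf by (subst (asm) \<theta>(2), subst (asm) sat_rewrite_entailed_comp) auto
      qed
      ultimately show "\<chi> \<in> rewrite_set N (?D t)"
        using \<theta>(2) by (auto simp: rewrite_set_def N_def)
    qed
    with t(1) show ?thesis
      by auto
  qed
  moreover have "\<exists>t\<ge>0. suffix t w \<Turnstile> Globally ((rewrite \<psi> (?D t))[rewrite_set M (?D t)]\<^sub>\<nu>)"
    if "\<psi> \<in> N" for \<psi>
  proof -
    have \<psi>: "\<psi> \<in> nu \<phi>"
      using that by (simp add: N_def)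
    then have "mu (rewrite \<psi> (?D r)) \<subseteq> rewrite_set (mu \<phi>) (?D r)"
      using mu_subset nu_subf unfolding mu_rewrite rewrite_set_def by (intro image_mono) blast
    \<comment> \<open>The witness for the third condition is \<open>t = r\<close>, from where all of
      \<open>N\<close> holds.\<close>
    moreover have "sat (suffix r w) n (rewrite \<psi> (?D r))" for n
      using N_holds[OF that, of "r + n"] \<psi> nu_subf by (subst sat_rewrite_entailed_comp) auto
    ultimately have "suffix r w \<Turnstile> Globally ((rewrite \<psi> (?D r))[rewrite_set M (?D r)]\<^sub>\<nu>)"
      using nu_r by simp
    then show ?thesis
      by blast
  qed
  ultimately have "?char M N"
    by (auto simp: M_def N_def)
  then show "\<exists>M N. ?char M N"
    by blast
next
  let ?D = "entailed_comp \<phi> w"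
  assume "\<exists>M N. ?char M N"
  then obtain M N where MN: "M \<subseteq> mu \<phi>" "N \<subseteq> nu \<phi>"
    and af: "suffix r w \<Turnstile> (af_prefix \<phi> w r)[rewrite_set M (?D r)]\<^sub>\<nu>"
    and M: "\<And>\<psi> s. \<psi> \<in> M \<Longrightarrow>
      \<exists>t\<ge>s. \<exists>n. sat (suffix t w) n ((rewrite \<psi> (?D t))[rewrite_set N (?D t)]\<^sub>\<mu>)"
    and N: "\<And>\<psi>. \<psi> \<in> N \<Longrightarrow>
      \<exists>t. \<forall>n. sat (suffix t w) n ((rewrite \<psi> (?D t))[rewrite_set M (?D t)]\<^sub>\<nu>)"
    by auto
  have subf: "M \<subseteq> subformulae \<phi>" "N \<subseteq> subformulae \<phi>"
    using MN by (auto simp: mu_def nu_def)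
  have fin_N: "finite N"
    using finite_subset[OF subf(2) finite_subformulae] .
  \<comment> \<open>The side condition covers only those elements of \<open>M\<close> whose
    rewriting occurs in \<open>\<chi>\<close>; inside the induction below only lighter ones are
    available.\<close>
  have nu_sound: "sat (suffix t w) n \<chi>"
    if M_inf: "\<And>\<theta> s. \<theta> \<in> M \<Longrightarrow> rewrite \<theta> (?D t) \<in> mu \<chi> \<Longrightarrow> \<exists>m\<ge>s. sat w m \<theta>"
      and \<chi>: "sat (suffix t w) n (\<chi>[rewrite_set M (?D t)]\<^sub>\<nu>)" for \<chi> t n
  proof (rule sat_rewrite_nu_imp_sat[OF _ \<chi>])
    fix \<psi> k
    assume "\<psi> \<in> mu \<chi>" "\<psi> \<in> rewrite_set M (?D t)"
    then obtain \<theta> where \<theta>: "\<theta> \<in> M" "\<psi> = rewrite \<theta> (?D t)" "rewrite \<theta> (?D t) \<in> mu \<chi>"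
      by (auto simp: rewrite_set_def)
    from M_inf[OF \<theta>(1,3)] obtain m where m: "m \<ge> t + k" "sat w m \<theta>"
      by blast
    then have "sat (suffix t w) (m - t) \<psi>"
      using \<theta> subf(1) by (simp add: sat_rewrite_entailed_comp subset_iff)
    with m(1) show "\<exists>m\<ge>k. sat (suffix t w) m \<psi>"
      by (intro exI[of _ "m - t"]) auto
  qed
  text \<open>The side conditions on a formula in \<open>M\<close> only refer to elements of \<open>N\<close> of smaller weight,
    and vice versa; rewriting past operators preserves weights, so the identification of
    formulae by \<open>?D t\<close> does no harm.\<close>
  have limit: "(\<psi> \<in> M \<longrightarrow> (\<forall>s. \<exists>t\<ge>s. sat w t \<psi>)) \<and> (\<psi> \<in> N \<longrightarrow> (\<exists>s. \<forall>t\<ge>s. sat w t \<psi>))" for \<psi>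
  proof (induction \<psi> rule: measure_induct_rule[of weight])
    case (less \<psi>)
    have "\<exists>t\<ge>s. sat w t \<psi>" if \<psi>: "\<psi> \<in> M" for s
    proof -
      let ?N = "{\<theta> \<in> N. weight \<theta> < weight \<psi>}"
      have "\<forall>\<theta>\<in>?N. \<exists>s. \<forall>t\<ge>s. sat w t \<theta>"
        using less by blast
      then obtain f where f: "\<And>\<theta> t. \<theta> \<in> ?N \<Longrightarrow> t \<ge> f \<theta> \<Longrightarrow> sat w t \<theta>"
        by metis
      \<comment> \<open>Beyond \<open>b\<close> all lighter elements of the finite set
        \<open>N\<close> hold; including \<open>s\<close> ensures that the position found is late
        enough.\<close>
      define b where "b = Max (insert s (f ` ?N))"
      have b: "b \<ge> s" "\<And>\<theta>. \<theta> \<in> ?N \<Longrightarrow> b \<ge> f \<theta>"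
        using fin_N by (auto simp: b_def)
      obtain t n where t: "t \<ge> b" "sat (suffix t w) n ((rewrite \<psi> (?D t))[rewrite_set N (?D t)]\<^sub>\<mu>)"
        using M[OF \<psi>] by blast
      have "sat (suffix t w) n (rewrite \<psi> (?D t))"
      proof (rule sat_rewrite_mu_imp_sat[OF _ t(2)])
        fix \<chi> k
        assume \<chi>: "\<chi> \<in> nu (rewrite \<psi> (?D t))" "\<chi> \<in> rewrite_set N (?D t)"
        then obtain \<theta> where \<theta>: "\<theta> \<in> N" "\<chi> = rewrite \<theta> (?D t)"
          by (auto simp: rewrite_set_def)
        \<comment> \<open>Rewriting need not be injective: \<open>\<theta>\<close> in
          \<open>N\<close> and \<open>\<theta>'\<close> below \<open>\<psi>\<close> may differ, but
          they have the same weight.\<close>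
        obtain \<theta>' where "\<theta>' \<in> nu \<psi>" "\<chi> = rewrite \<theta>' (?D t)"
          using \<chi>(1) by (auto simp: nu_rewrite)
        then have "weight \<theta> < weight \<psi>"
          using weight_nu_less \<psi> MN(1) \<theta>(2) by (metis subsetD weight_rewrite)
        then have "sat w (t + k) \<theta>"
          using f[of \<theta> "t + k"] b(2)[of \<theta>] t(1) \<theta>(1) by simp
        then show "sat (suffix t w) k \<chi>"
          using \<theta> subf(2) by (simp add: sat_rewrite_entailed_comp subset_iff)
      qed
      then have "sat w (t + n) \<psi>"
        using \<psi> subf(1) by (simp add: sat_rewrite_entailed_comp subset_iff)
      with t(1) b(1) show ?thesis
        by (intro exI[of _ "t + n"]) simp
    qed
    moreover have "\<exists>s. \<forall>t\<ge>s. sat w t \<psi>" if \<psi>: "\<psi> \<in> N"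
    proof -
      obtain t where t: "\<And>n. sat (suffix t w) n ((rewrite \<psi> (?D t))[rewrite_set M (?D t)]\<^sub>\<nu>)"
        using N[OF \<psi>] by blast
      \<comment> \<open>Any \<open>t\<close> from the third condition works without a threshold,
        since recurrence of the lighter elements of \<open>M\<close> is insensitive to the starting
        position.\<close>
      have "sat (suffix t w) n (rewrite \<psi> (?D t))" for n
      proof (rule nu_sound[OF _ t])
        fix \<theta> s
        assume \<theta>: "\<theta> \<in> M" "rewrite \<theta> (?D t) \<in> mu (rewrite \<psi> (?D t))"
        then obtain \<theta>' where "\<theta>' \<in> mu \<psi>" "rewrite \<theta> (?D t) = rewrite \<theta>' (?D t)"
          by (auto simp: mu_rewrite)
        then have "weight \<theta> < weight \<psi>"
          using weight_mu_less \<psi> MN(2) by (metis subsetD weight_rewrite)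
        with less \<theta>(1) show "\<exists>m\<ge>s. sat w m \<theta>"
          by blast
      qed
      then have "sat w (t + n) \<psi>" for n
        using \<psi> subf(2) by (simp add: sat_rewrite_entailed_comp subset_iff)
      then show ?thesis
        by (metis le_Suc_ex)
    qed
    ultimately show ?case
      by blast
  qed
  \<comment> \<open>With recurrence known for all of \<open>M\<close>, the rewriting in the first
    condition can be undone.\<close>
  have "suffix r w \<Turnstile> af_prefix \<phi> w r"
    using limit by (intro nu_sound[OF _ af]) blast
  then show "w \<Turnstile> \<phi>"
    by (simp only: sat_af_prefix)
qed

end
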